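(* Let $k\ge1$ be an integer and $\lambda,\delta,\gamma>0$. Let $\{N^{(k)}(t)\}_{t\ge0}$ be the Poisson process of order $k$ with parameter $\lambda$ and $p_m(x)=\mathbb{P}[N^{(k)}(x)=m]$. Let $\{G(t)\}_{t\ge0}$ be the inverse Gaussian subordinator with parameters $\delta,\gamma$, let $E_G(t)=\inf\{r\ge0:G(r)>t\}$, $t\ge0$, be independent of $\{N^{(k)}(t)\}_{t\ge0}$, let $h(x,t)$ be the density (in $x$) of $E_G(t)$, and let $\hat p_m(t)=\mathbb{P}[N^{(k)}(E_G(t))=m]$. Then $\hat p_m$ satisfies the following difference-differential equation: for $m=1,2,\ldots$, $$\begin{aligned}\frac{d}{dt}\hat p_m(t)=\frac{1}{2\delta^2}\Bigg[&\int_0^\infty\Bigg((k\lambda)^2p_m(x)-2k\lambda^2\sum_{j=1}^{m\wedge k}p_{m-j}(x)+\lambda^2\sum_{j=1}^{m\wedge k}\Bigg(\sum_{i=1}^{(m-j)\wedge k}p_{m-j-i}(x)\Bigg)\Bigg)h(x,t)\,dx\\&+2\delta\gamma\int_0^\infty\Bigg(-k\lambda p_m(x)+\lambda\sum_{j=1}^{m\wedge k}p_{m-j}(x)\Bigg)h(x,t)\,dx+h(0,t)\,p_m'(0)\Bigg]-\delta_0(t)\hat p_m(0),\end{aligned}$$ and for $m=0$, $$\frac{d}{dt}\hat p_0(t)=\frac{1}{2\delta^2}\left[\int_0^\infty(k\lambda)^2p_0(x)h(x,t)\,dx-2k\lambda\delta\gamma\int_0^\infty p_0(x)h(x,t)\,dx-k\lambda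 h(0,t)\right]-\delta_0(t)\hat p_0(0),$$ with initial condition $p_m'(0)=-k\lambda$ if $m=0$, $p_m'(0)=\lambda$ if $m=1,2,\ldots,k$, and $p_m'(0)=0$ if $m\ge k+1$.
   Context: $a\wedge b=\min\{a,b\}$; empty sums are zero. $\delta_0(t)$ denotes the Dirac delta at $t=0$ (distinct from the parameter $\delta$). $h(0,t)$ is the boundary value of $h(x,t)$ at $x=0$. Poisson process of order $k$ (PPoK) with parameter $\lambda$: $N^{(k)}(t)=\sum_{i=0}^{N(t,k\lambda)}X_i$, where $\{N(t,k\lambda)\}_{t\ge0}$ is a Poisson process of rate $k\lambda$, $X_0\equiv 0$, and $\{X_i\}_{i\ge 1}$ are IID uniform on $\{1,2,\ldots,k\}$, independent of the Poisson process. Inverse Gaussian subordinator: the non-decreasing Lévy process $\{G(t)\}_{t\ge0}$ with $\mathbb{E}[e^{-sG(t)}]=e^{-tf(s)}$, $f(s)=\delta(\sqrt{2s+\gamma^2}-\gamma)$, i.e. zero drift and Lévy measure $\nu(dx)=\frac{\delta}{\sqrt{2\pi x^3}}e^{-\gamma^2x/2}\,dx$, $x>0$.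
   Formalization: For m=0 the equation is asserted only for t>0, where the delta term vanishes: since p̂_0(0)=1, the printed term −δ_0(t)p̂_0(0) is wrong at t=0 (the zero extension has derivative bracket + δ_0(t)). For m≥1 the point t=0 is included. *)

theory Defs
  imports "HOL-Probability.Probability"
begin

text \<open>Processes are functions of a time (or index) and a sample point. Continuous-time processes
  are indexed by \<^typ>\<open>real\<close>, but only their values at times \<open>t \<ge> 0\<close> are constrained or used.\<close>

text \<open>The sigma-algebra generated by the family \<open>(X i)\<close>, \<open>i \<in> I\<close>, with state space \<open>S\<close>.\<close>

definition process_sigma ::
    "'a measure \<Rightarrow> 'i set \<Rightarrow> 's measure \<Rightarrow> ('i \<Rightarrow> 'a \<Rightarrow> 's) \<Rightarrow> 'a set set" where
  "process_sigma M I S X =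
     sigma_sets (space M) (\<Union>i\<in>I. {X i -` A \<inter> space M | A. A \<in> sets S})"

definition indep_processes ::
    "'a measure \<Rightarrow> 'i set \<Rightarrow> 's measure \<Rightarrow> ('i \<Rightarrow> 'a \<Rightarrow> 's) \<Rightarrow>
     'j set \<Rightarrow> 'r measure \<Rightarrow> ('j \<Rightarrow> 'a \<Rightarrow> 'r) \<Rightarrow> bool" where
  "indep_processes M I S X J T Y \<longleftrightarrow>
     prob_space.indep_set M (process_sigma M I S X) (process_sigma M J T Y)"

text \<open>Real-valued Levy processes. Every sample path, not only almost every one, is
  right-continuous with left limits; stochastic continuity is then automatic.\<close>

definition levy_process :: "'a measure \<Rightarrow> (real \<Rightarrow> 'a \<Rightarrow> real) \<Rightarrow> bool" where
  "levy_process M X \<longleftrightarrow>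
     prob_space M \<and>
     (\<forall>t\<ge>0. X t \<in> borel_measurable M) \<and>
     (AE \<omega> in M. X 0 \<omega> = 0) \<and>
     (\<forall>\<omega>\<in>space M. \<forall>t\<ge>0. ((\<lambda>s. X s \<omega>) \<longlongrightarrow> X t \<omega>) (at_right t)) \<and>
     (\<forall>\<omega>\<in>space M. \<forall>t>0. \<exists>l. ((\<lambda>s. X s \<omega>) \<longlongrightarrow> l) (at_left t)) \<and>
     (\<forall>n. \<forall>\<tau> :: nat \<Rightarrow> real. 0 \<le> \<tau> 0 \<and> (\<forall>i<n. \<tau> i \<le> \<tau> (Suc i)) \<longrightarrow>
        prob_space.indep_vars M (\<lambda>_. borel) (\<lambda>i \<omega>. X (\<tau> (Suc i)) \<omega> - X (\<tau> i) \<omega>) {..<n}) \<and>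
     (\<forall>s\<ge>0. \<forall>t\<ge>0. distr M borel (\<lambda>\<omega>. X (s + t) \<omega> - X s \<omega>) = distr M borel (X t))"

definition poisson_process :: "'a measure \<Rightarrow> real \<Rightarrow> (real \<Rightarrow> 'a \<Rightarrow> nat) \<Rightarrow> bool" where
  "poisson_process M \<mu> P \<longleftrightarrow>
     levy_process M (\<lambda>t \<omega>. real (P t \<omega>)) \<and>
     (\<forall>t\<ge>0. P t \<in> measurable M (count_space UNIV)) \<and>
     (\<forall>t>0. distr M (count_space UNIV) (P t) = measure_pmf (poisson_pmf (\<mu> * t)))"

text \<open>The data from which a Poisson process of order \<open>k\<close> is built: a Poisson process of rate
  \<open>k * lam\<close> and an independent IID sequence \<open>X 1, X 2, \<dots>\<close>, uniform on \<open>{1..k}\<close>, with \<open>X 0 = 0\<close>.\<close>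

definition ppok_data ::
    "'a measure \<Rightarrow> nat \<Rightarrow> real \<Rightarrow> (real \<Rightarrow> 'a \<Rightarrow> nat) \<Rightarrow> (nat \<Rightarrow> 'a \<Rightarrow> nat) \<Rightarrow> bool" where
  "ppok_data M k lam P X \<longleftrightarrow>
     poisson_process M (real k * lam) P \<and>
     (\<forall>\<omega>\<in>space M. X 0 \<omega> = 0) \<and>
     prob_space.indep_vars M (\<lambda>_. count_space UNIV) X {1..} \<and>
     (\<forall>i\<ge>1. distr M (count_space UNIV) (X i) = measure_pmf (pmf_of_set {1..k})) \<and>
     indep_processes M {1..} (count_space UNIV) X {0..} (count_space UNIV) P"

definition ppok :: "(real \<Rightarrow> 'a \<Rightarrow> nat) \<Rightarrow> (nat \<Rightarrow> 'a \<Rightarrow> nat) \<Rightarrow> real \<Rightarrow> 'a \<Rightarrow> nat" where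
  "ppok P X t \<omega> = (\<Sum>i = 0..P t \<omega>. X i \<omega>)"

definition inverse_gaussian_subordinator ::
    "'a measure \<Rightarrow> real \<Rightarrow> real \<Rightarrow> (real \<Rightarrow> 'a \<Rightarrow> real) \<Rightarrow> bool" where
  "inverse_gaussian_subordinator M \<delta> \<gamma> G \<longleftrightarrow>
     levy_process M G \<and>
     (\<forall>\<omega>\<in>space M. mono_on {0..} (\<lambda>t. G t \<omega>)) \<and>
     (\<forall>t\<ge>0. \<forall>s\<ge>0. prob_space.expectation M (\<lambda>\<omega>. exp (- s * G t \<omega>)) =
                       exp (- t * (\<delta> * (sqrt (2 * s + \<gamma>\<^sup>2) - \<gamma>))))"

text \<open>The infimum of the empty set would be infinite; for the subordinators above this happens
  only on a null event, where the value is set to 0 so that the process stays real-valued and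
  non-negative.\<close>

definition first_exit_time :: "(real \<Rightarrow> 'a \<Rightarrow> real) \<Rightarrow> real \<Rightarrow> 'a \<Rightarrow> real" where
  "first_exit_time G t \<omega> =
     (if \<exists>r\<ge>0. G r \<omega> > t then Inf {r. 0 \<le> r \<and> G r \<omega> > t} else 0)"

text \<open>Distributions. A function \<open>u\<close> on \<open>[0, \<infinity>)\<close> is regarded as a distribution on the line after
  extension by zero to negative times.\<close>

definition test_function_on :: "real set \<Rightarrow> (real \<Rightarrow> real) \<Rightarrow> bool" where
  "test_function_on U \<phi> \<longleftrightarrow>
     (\<forall>n x. (deriv ^^ n) \<phi> field_differentiable at x) \<and>
     (\<exists>K. compact K \<and> K \<subseteq> U \<and> (\<forall>x. x \<notin> K \<longrightarrow> \<phi> x = 0))"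

definition causal_dist :: "(real \<Rightarrow> real) \<Rightarrow> (real \<Rightarrow> real) \<Rightarrow> real" where
  "causal_dist u \<phi> = (LINT t:{0<..}|lborel. u t * \<phi> t)"

definition dist_deriv :: "((real \<Rightarrow> real) \<Rightarrow> real) \<Rightarrow> (real \<Rightarrow> real) \<Rightarrow> real" where
  "dist_deriv T \<phi> = - T (deriv \<phi>)"

definition dirac_delta :: "(real \<Rightarrow> real) \<Rightarrow> real" where
  "dirac_delta \<phi> = \<phi> 0"

end

theory Submission
  imports Defs "HOL-Real_Asymp.Real_Asymp"
begin

text \<open>Let \<open>F x t\<close> be the inverse Gaussian distribution function, i.e. the probability of \<open>G x \<le> t\<close>.
  It is explicit in terms of the normal distribution function (identified through its Laplace
  transform) and satisfies \<open>2 \<delta>\<^sup>2 F\<^sub>t = F\<^sub>x\<^sub>x - 2 \<delta> \<gamma> F\<^sub>x\<close>. Since \<open>E t \<ge> x\<close> iff \<open>G x \<le> t\<close> almost surely,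
  \<open>F x t\<close> is also the tail of \<open>E t\<close>, so for a smooth bounded \<open>q\<close> the expectation of \<open>q (E t)\<close> is
  \<open>q 0 + \<integral> q' x F x t dx\<close>, and its time derivative is \<open>\<integral> q' x F\<^sub>t x t dx\<close>. Replacing \<open>F\<^sub>t\<close> by
  space derivatives and integrating by parts gives expectations of \<open>q''\<close> and \<open>q'\<close> at \<open>E t\<close>
  and a boundary term with the density \<open>- F\<^sub>x 0 t\<close> of \<open>E t\<close> at \<open>0\<close>. For \<open>q = p m\<close> the derivatives are
  computed by Kolmogorov's forward equations of the process of order \<open>k\<close>.\<close>

section \<open>Uniqueness of Laplace transforms\<close>

text \<open>Differentiating the integral of \<open>q' x F x t\<close> under the integral sign would
  call for a domination of \<open>F\<^sub>t\<close> that is locally uniform in time. Instead, Fubini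
  presents this integral as a primitive in time of the integral of
  \<open>q' x F\<^sub>t x u\<close>, so that only continuity of the latter in u is missing.
  Integration by parts supplies it: it expresses the integral through integrals against
  \<open>F\<close>, which are primitives in time and hence continuous. As the integration by parts
  starts from \<open>q'\<close>, three derivatives of \<open>q\<close> occur; the tail formula, read
  backwards, then turns integrals of \<open>q''\<close> and \<open>q'''\<close> against
  \<open>F\<close> into expectations.

  The delta term comes from extending by zero to negative times: the jump at 0 adds plus the right
  limit times delta. For m \<ge> 1 both this limit and \<open>phat m 0\<close> are 0. For m = 0 the
  limit is 1, opposite in sign to the term in the equation, which is therefore tested on functions
  supported in positive times, where delta vanishes.\<close>

lemma laplace_transform_continuous:
  fixes \<mu> \<nu> :: "real measure" and f :: "real \<Rightarrow> real"
  assumes \<mu>: "real_distribution \<mu>" "AE y in \<mu>. 0 \<le> y"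
    and \<nu>: "real_distribution \<nu>" "AE y in \<nu>. 0 \<le> y"
    and lt: "\<And>n::nat. (\<integral>y. exp (- real n * y) \<partial>\<mu>) = (\<integral>y. exp (- real n * y) \<partial>\<nu>)"
    and f: "continuous_on UNIV f"
  shows "(\<integral>y. f (exp (- y)) \<partial>\<mu>) = (\<integral>y. f (exp (- y)) \<partial>\<nu>)"
proof -
  interpret M: real_distribution \<mu> by fact
  interpret N: real_distribution \<nu> by fact
  have fm[measurable]: "f \<in> borel_measurable borel"
    using f by (rule borel_measurable_continuous_onI)
  have fc: "continuous_on {0..1} f" using f continuous_on_subset by blast
  have "compact (f ` {0..1})" using fc by (intro compact_continuous_image) auto
  then obtain B where "\<forall>y\<in>f ` {0..1}. norm y \<le> B"
    using compact_imp_bounded bounded_iff by metis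
  then have B: "\<bar>f x\<bar> \<le> B" if "0 \<le> x" "x \<le> 1" for x using that by auto
  have int_f: "integrable \<rho> (\<lambda>y. f (exp (- y)))"
    if "real_distribution \<rho>" "AE y in \<rho>. 0 \<le> y" for \<rho>
  proof -
    interpret R: real_distribution \<rho> by fact
    show ?thesis
      by (rule R.integrable_const_bound[where B = B]) (use that(2) B in \<open>auto elim!: eventually_mono\<close>)
  qed
  have int_e: "integrable \<rho> (\<lambda>y. exp (- (real n * y)))"
    if "real_distribution \<rho>" "AE y in \<rho>. 0 \<le> y" for \<rho> and n :: nat
  proof -
    interpret R: real_distribution \<rho> by fact
    show ?thesis
      by (rule R.integrable_const_bound[where B = 1]) (use that(2) in \<open>auto elim!: eventually_mono\<close>)
  qed
  show ?thesis
  proof (rule ccontr)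
    assume ne: "\<not> ?thesis"
    \<comment> \<open>In the variable \<open>exp (- y)\<close>, which lies in [0,1] almost surely,
      \<open>lt\<close> says that all moments agree, hence the integrals of all polynomials.
      Approximating \<open>f\<close> within \<open>e\<close> under both measures leaves a gap of at
      most 2e, whereas by this choice the gap is 3e > 0.\<close>
    define e where "e = \<bar>(\<integral>y. f (exp (- y)) \<partial>\<mu>) - (\<integral>y. f (exp (- y)) \<partial>\<nu>)\<bar> / 3"
    have e: "e > 0" using ne by (simp add: e_def)
    obtain g where g: "real_polynomial_function g" "\<And>x. x \<in> {0..1} \<Longrightarrow> \<bar>f x - g x\<bar> < e"
      using Stone_Weierstrass_real_polynomial_function[OF _ fc e] by auto
    then obtain a n where ga: "g = (\<lambda>x. \<Sum>i\<le>n. a i * x ^ i)"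
      using real_polynomial_function_iff_sum by auto
    have ge: "g (exp (- y)) = (\<Sum>i\<le>n. a i * exp (- (real i * y)))" for y
      by (simp add: ga flip: exp_of_nat_mult)
    have close: "\<bar>(\<integral>y. f (exp (- y)) \<partial>\<rho>) - (\<integral>y. g (exp (- y)) \<partial>\<rho>)\<bar> \<le> e"
      if \<rho>: "real_distribution \<rho>" "AE y in \<rho>. 0 \<le> y" for \<rho>
    proof -
      interpret R: real_distribution \<rho> by fact
      have ig: "integrable \<rho> (\<lambda>y. g (exp (- y)))"
        unfolding ge by (intro Bochner_Integration.integrable_sum integrable_mult_right int_e \<rho>)
      have "\<bar>(\<integral>y. f (exp (- y)) \<partial>\<rho>) - (\<integral>y. g (exp (- y)) \<partial>\<rho>)\<bar>
          = \<bar>\<integral>y. f (exp (- y)) - g (exp (- y)) \<partial>\<rho>\<bar>"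
        using int_f[OF \<rho>] ig by simp
      also have "\<dots> \<le> (\<integral>y. \<bar>f (exp (- y)) - g (exp (- y))\<bar> \<partial>\<rho>)"
        by (rule integral_abs_bound)
      also have "\<dots> \<le> (\<integral>y. e \<partial>\<rho>)"
      proof (rule integral_mono_AE)
        show "integrable \<rho> (\<lambda>y. \<bar>f (exp (- y)) - g (exp (- y))\<bar>)"
          using int_f[OF \<rho>] ig by simp
        show "AE y in \<rho>. \<bar>f (exp (- y)) - g (exp (- y))\<bar> \<le> e"
          using \<rho>(2) by eventually_elim (intro less_imp_le g(2), auto)
      qed auto
      also have "\<dots> = e" using R.prob_space by simp
      finally show ?thesis .
    qed
    have "(\<integral>y. g (exp (- y)) \<partial>\<mu>) = (\<integral>y. g (exp (- y)) \<partial>\<nu>)"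
      unfolding ge using lt int_e \<mu> \<nu> by simp
    moreover have "3 * e = \<bar>(\<integral>y. f (exp (- y)) \<partial>\<mu>) - (\<integral>y. f (exp (- y)) \<partial>\<nu>)\<bar>"
      by (simp add: e_def)
    ultimately show False
      using close[OF \<mu>] close[OF \<nu>] e by (simp only: abs_le_iff abs_real_def split: if_splits)
  qed
qed

text \<open>Integer arguments suffice because the indicator of \<open>{..a}\<close> is a bounded
  limit of continuous functions of \<open>exp (- y)\<close>.\<close>

theorem laplace_transform_unique:
  fixes \<mu> \<nu> :: "real measure"
  assumes \<mu>: "real_distribution \<mu>" "AE y in \<mu>. 0 \<le> y"
    and \<nu>: "real_distribution \<nu>" "AE y in \<nu>. 0 \<le> y"
    and lt: "\<And>n::nat. (\<integral>y. exp (- real n * y) \<partial>\<mu>) = (\<integral>y. exp (- real n * y) \<partial>\<nu>)"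
  shows "\<mu> = \<nu>"
proof (rule cdf_unique[OF \<mu>(1) \<nu>(1)], rule ext)
  fix a :: real
  \<comment> \<open>A ramp in z = exp(-y): it is 1 for z \<ge> exp(-a), that is for y \<le> a, and 0
    once z is at least 1/n below exp(-a).\<close>
  define f where "f n z = max 0 (min 1 (1 + real n * (z - exp (- a))))" for n :: nat and z
  have lim: "(\<lambda>n. \<integral>y. f n (exp (- y)) \<partial>\<rho>) \<longlonglongrightarrow> cdf \<rho> a"
    if \<rho>: "real_distribution \<rho>" for \<rho>
  proof -
    interpret R: real_distribution \<rho> by fact
    have "(\<lambda>n. \<integral>y. f n (exp (- y)) \<partial>\<rho>) \<longlonglongrightarrow> (\<integral>y. indicator {..a} y \<partial>\<rho>)"
    proof (rule integral_dominated_convergence[where w = "\<lambda>_. 1"])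
      show "AE y in \<rho>. (\<lambda>n. f n (exp (- y))) \<longlonglongrightarrow> indicator {..a} y"
      proof (rule AE_I2)
        fix y
        show "(\<lambda>n. f n (exp (- y))) \<longlonglongrightarrow> indicator {..a} y"
        proof (cases "y \<le> a")
          case True
          have "f n (exp (- y)) = 1" for n using True by (auto simp: f_def)
          then show ?thesis using True by simp
        next
          case False
          define d where "d = exp (- a) - exp (- y)"
          have d: "d > 0" using False by (simp add: d_def)
          obtain n0 :: nat where n0: "1 / d < real n0" using reals_Archimedean2 by blast
          have "f n (exp (- y)) = 0" if "n \<ge> n0" for n
          proof -
            have "1 / d < real n" using n0 that by linarith
            then have "1 < real n * d" using d by (simp add: field_simps)
            then show ?thesis by (simp add: f_def d_def algebra_simps)
          qed
          then have "eventually (\<lambda>n. f n (exp (- y)) = 0) sequentially"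
            by (auto simp: eventually_sequentially)
          then show ?thesis using False by (simp add: tendsto_eventually)
        qed
      qed
    qed (auto simp: f_def)
    then show ?thesis by (simp add: cdf_def)
  qed
  have "(\<integral>y. f n (exp (- y)) \<partial>\<mu>) = (\<integral>y. f n (exp (- y)) \<partial>\<nu>)" for n
    by (rule laplace_transform_continuous[OF \<mu> \<nu> lt])
       (auto simp: f_def intro!: continuous_intros)
  then show "cdf \<mu> a = cdf \<nu> a"
    using LIMSEQ_unique[OF lim[OF \<mu>(1)]] lim[OF \<nu>(1)] by simp
qed

section \<open>The inverse Gaussian distribution function\<close>

definition std_normal_cdf :: "real \<Rightarrow> real" where
  "std_normal_cdf = cdf std_normal_distribution"

interpretation std_normal: real_distribution std_normal_distribution
  by (rule real_dist_normal_dist)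

lemma std_normal_density_minus: "std_normal_density (- x) = std_normal_density x"
  by (simp add: std_normal_density_def)

lemma isCont_std_normal_density: "isCont std_normal_density x"
  unfolding std_normal_density_def by (intro continuous_intros) auto

lemma std_normal_cdf_nonneg: "0 \<le> std_normal_cdf x"
  by (simp add: std_normal_cdf_def cdf_def)

lemma std_normal_cdf_at_top: "(std_normal_cdf \<longlongrightarrow> 1) at_top"
  unfolding std_normal_cdf_def by (rule std_normal.cdf_lim_at_top_prob)

lemma std_normal_cdf_at_bot: "(std_normal_cdf \<longlongrightarrow> 0) at_bot"
  unfolding std_normal_cdf_def by (rule std_normal.cdf_lim_at_bot)

lemma std_normal_cdf_diff:
  assumes "a \<le> b"
  shows "std_normal_cdf b - std_normal_cdf a = integral {a..b} std_normal_density"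
proof (cases "a = b")
  case False
  with assms have ab: "a < b" by simp
  have "std_normal_cdf b - std_normal_cdf a = measure std_normal_distribution {a<..b}"
    unfolding std_normal_cdf_def by (rule std_normal.cdf_diff_eq[OF ab])
  also have "\<dots> = (\<integral>x. indicator {a<..b} x \<partial>std_normal_distribution)" by simp
  also have "\<dots> = (\<integral>x. std_normal_density x * indicator {a<..b} x \<partial>lborel)"
    by (subst integral_density) (auto simp: normal_density_nonneg)
  also have "\<dots> = (\<integral>x. indicator {a..b} x *\<^sub>R std_normal_density x \<partial>lborel)"
    by (rule integral_cong_AE)
       (use AE_lborel_singleton[of a] in \<open>auto elim!: eventually_mono simp: indicator_def\<close>)
  also have "\<dots> = integral {a..b} std_normal_density"
    by (subst set_borel_integral_eq_integral(2)[symmetric])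
       (auto simp: set_lebesgue_integral_def isCont_std_normal_density
         intro!: borel_integrable_atLeastAtMost' continuous_at_imp_continuous_on)
  finally show ?thesis .
qed simp

lemma std_normal_cdf_has_derivative:
  "(std_normal_cdf has_real_derivative std_normal_density x) (at x)"
proof -
  have "((\<lambda>u. integral {x - 1..u} std_normal_density) has_real_derivative std_normal_density x)
      (at x within {x - 1..x + 1})"
    by (rule integral_has_real_derivative)
       (auto intro!: continuous_at_imp_continuous_on isCont_std_normal_density)
  then have "((\<lambda>u. integral {x - 1..u} std_normal_density) has_real_derivative std_normal_density x) (at x)"
    by (subst (asm) at_within_interior) auto
  then have "((\<lambda>u. integral {x - 1..u} std_normal_density + std_normal_cdf (x - 1))
      has_real_derivative std_normal_density x) (at x)"
    by (auto intro!: derivative_eq_intros)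
  then show ?thesis
  proof (rule DERIV_cong_ev[THEN iffD1, rotated 3])
    show "\<forall>\<^sub>F u in nhds x. integral {x - 1..u} std_normal_density + std_normal_cdf (x - 1) = std_normal_cdf u"
      using eventually_nhds_in_open[of "{x - 1<..}" x]
      by (auto elim!: eventually_mono simp flip: std_normal_cdf_diff)
  qed auto
qed

lemma isCont_std_normal_cdf: "isCont std_normal_cdf x"
  using DERIV_isCont std_normal_cdf_has_derivative by blast

lemma borel_measurable_std_normal_cdf [measurable]: "std_normal_cdf \<in> borel_measurable borel"
  by (intro borel_measurable_continuous_onI continuous_at_imp_continuous_on ballI isCont_std_normal_cdf)

text \<open>The density is even, so the sum of the two values has derivative 0, and its limit at
  infinity is 1. This is why \<open>ig_cdf\<close> starts at 1 for x = 0.\<close>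

lemma std_normal_cdf_minus: "std_normal_cdf (- x) = 1 - std_normal_cdf x"
proof -
  define s where "s x = std_normal_cdf x + std_normal_cdf (- x)" for x
  have d: "(s has_real_derivative 0) (at y)" for y
  proof -
    have "((\<lambda>x. std_normal_cdf (- x)) has_real_derivative std_normal_density (- y) * - 1) (at y)"
      by (rule DERIV_chain'[OF DERIV_minus[OF DERIV_ident] std_normal_cdf_has_derivative])
    from DERIV_add[OF std_normal_cdf_has_derivative this] show ?thesis
      by (simp add: s_def[abs_def] std_normal_density_minus)
  qed
  have c: "s y = s x" for y by (rule DERIV_isconst_all) (intro allI d)
  have "(s \<longlongrightarrow> 1 + 0) at_top"
    unfolding s_def[abs_def]
    by (intro tendsto_add std_normal_cdf_at_top
          filterlim_compose[OF std_normal_cdf_at_bot filterlim_uminus_at_bot_at_top])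
  moreover have "(s \<longlongrightarrow> s x) at_top"
    by (rule tendsto_eventually) (intro always_eventually allI c)
  ultimately have "1 + 0 = s x" by (rule tendsto_unique[OF trivial_limit_at_top_linorder])
  then show ?thesis by (simp add: s_def)
qed

text \<open>Negating the drift parameter gives -(\<gamma> t + \<delta> x) / sqrt t, so one
  expression serves as the direct and as the reflected argument.\<close>

definition ig_arg :: "real \<Rightarrow> real \<Rightarrow> real \<Rightarrow> real \<Rightarrow> real" where
  "ig_arg \<delta> \<gamma> x t = (\<gamma> * t - \<delta> * x) / sqrt t"

text \<open>The law of the first passage of Brownian motion with drift \<gamma> to the level
  \<delta> x; the second summand is the reflection term.\<close>

definition ig_cdf :: "real \<Rightarrow> real \<Rightarrow> real \<Rightarrow> real \<Rightarrow> real" where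
  "ig_cdf \<delta> \<gamma> x t = std_normal_cdf (ig_arg \<delta> \<gamma> x t)
     + exp (2 * \<delta> * \<gamma> * x) * std_normal_cdf (ig_arg \<delta> (- \<gamma>) x t)"

text \<open>For t > 0 this is \<delta> x (2 pi t^3)^(-1/2) exp(-(\<gamma> t - \<delta> x)^2 / (2
  t)), the inverse Gaussian density in t.\<close>

definition ig_density :: "real \<Rightarrow> real \<Rightarrow> real \<Rightarrow> real \<Rightarrow> real" where
  "ig_density \<delta> \<gamma> x t = std_normal_density (ig_arg \<delta> \<gamma> x t) * (\<delta> * x / (t * sqrt t))"

text \<open>The factor 2 in front of the Gaussian arises because, after reflection, both summands of
  \<open>ig_cdf\<close> contribute the same Gaussian term to the space derivative.\<close>

definition ig_exit_density :: "real \<Rightarrow> real \<Rightarrow> real \<Rightarrow> real \<Rightarrow> real" where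
  "ig_exit_density \<delta> \<gamma> x t = 2 * \<delta> / sqrt t * std_normal_density (ig_arg \<delta> \<gamma> x t)
     - 2 * \<delta> * \<gamma> * (exp (2 * \<delta> * \<gamma> * x) * std_normal_cdf (ig_arg \<delta> (- \<gamma>) x t))"

lemma ig_arg_measurable [measurable]:
  assumes [measurable]: "f \<in> borel_measurable M" "g \<in> borel_measurable M"
  shows "(\<lambda>z. ig_arg \<delta> \<gamma> (f z) (g z)) \<in> borel_measurable M"
  unfolding ig_arg_def by measurable

lemma ig_density_measurable [measurable]:
  assumes [measurable]: "f \<in> borel_measurable M" "g \<in> borel_measurable M"
  shows "(\<lambda>z. ig_density \<delta> \<gamma> (f z) (g z)) \<in> borel_measurable M"
  unfolding ig_density_def by measurable

lemma ig_cdf_measurable [measurable]: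
  assumes [measurable]: "f \<in> borel_measurable M" "g \<in> borel_measurable M"
  shows "(\<lambda>z. ig_cdf \<delta> \<gamma> (f z) (g z)) \<in> borel_measurable M"
  unfolding ig_cdf_def by measurable

lemma ig_density_nonneg: "0 \<le> \<delta> \<Longrightarrow> 0 \<le> x \<Longrightarrow> 0 \<le> t \<Longrightarrow> 0 \<le> ig_density \<delta> \<gamma> x t"
  by (simp add: ig_density_def)

lemma ig_cdf_nonneg: "0 \<le> ig_cdf \<delta> \<gamma> x t"
  by (simp add: ig_cdf_def std_normal_cdf_nonneg)

lemma ig_arg_has_derivative_time:
  assumes "t > 0"
  shows "((\<lambda>t. ig_arg \<delta> \<gamma> x t) has_real_derivative
      \<gamma> / (2 * sqrt t) + \<delta> * x / (2 * (t * sqrt t))) (at t)"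
proof -
  define s where "s = sqrt t"
  have s: "s > 0" "t = s\<^sup>2" using assms by (auto simp: s_def)
  have "((\<lambda>t. ig_arg \<delta> \<gamma> x t) has_real_derivative
      (\<gamma> * sqrt t - (\<gamma> * t - \<delta> * x) * (inverse (sqrt t) / 2)) / (sqrt t * sqrt t)) (at t)"
    unfolding ig_arg_def[abs_def] using assms
    by (intro DERIV_divide DERIV_real_sqrt) (auto intro!: derivative_eq_intros)
  then show ?thesis
  proof (rule DERIV_cong)
    show "(\<gamma> * sqrt t - (\<gamma> * t - \<delta> * x) * (inverse (sqrt t) / 2)) / (sqrt t * sqrt t)
      = \<gamma> / (2 * sqrt t) + \<delta> * x / (2 * (t * sqrt t))"
      unfolding s_def[symmetric] unfolding s(2) using s(1)
      by (simp add: field_simps power2_eq_square)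
  qed
qed

lemma ig_arg_has_derivative_space:
  assumes "t > 0"
  shows "((\<lambda>x. ig_arg \<delta> \<gamma> x t) has_real_derivative - \<delta> / sqrt t) (at x)"
  unfolding ig_arg_def[abs_def] using assms
  by (auto intro!: derivative_eq_intros simp: field_simps)

lemma ig_arg_square:
  assumes "t > 0"
  shows "(ig_arg \<delta> \<gamma> x t)\<^sup>2 = \<gamma>\<^sup>2 * t - 2 * \<delta> * \<gamma> * x + \<delta>\<^sup>2 * x\<^sup>2 / t"
  using assms by (simp add: ig_arg_def power_divide power2_diff field_simps power2_eq_square)

text \<open>Changing the drift parameter only rescales the Gaussian factor; this is both the reflection
  identity behind \<^const>\<open>ig_cdf\<close> and the exponential tilting that yields its Laplace transform.\<close>

lemma ig_gauss_tilt:
  assumes "t > 0"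
  shows "std_normal_density (ig_arg \<delta> \<gamma>' x t) =
    exp (- (\<gamma>'\<^sup>2 - \<gamma>\<^sup>2) / 2 * t + \<delta> * (\<gamma>' - \<gamma>) * x) * std_normal_density (ig_arg \<delta> \<gamma> x t)"
  unfolding std_normal_density_def ig_arg_square[OF assms]
  by (simp add: exp_add[symmetric] field_simps)

lemma ig_gauss_reflect:
  assumes "t > 0"
  shows "exp (2 * \<delta> * \<gamma> * x) * std_normal_density (ig_arg \<delta> (- \<gamma>) x t)
    = std_normal_density (ig_arg \<delta> \<gamma> x t)"
  by (subst ig_gauss_tilt[OF assms, of \<delta> \<gamma> x "- \<gamma>"]) (simp add: mult_ac)

text \<open>By reflection both summands carry the same Gaussian factor; the contributions of the
  drift cancel and the two halves of \<delta> x / (t sqrt t) add up.\<close>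

lemma ig_cdf_has_derivative_time:
  assumes "t > 0"
  shows "((\<lambda>t. ig_cdf \<delta> \<gamma> x t) has_real_derivative ig_density \<delta> \<gamma> x t) (at t)"
proof -
  have "((\<lambda>t. ig_cdf \<delta> \<gamma> x t) has_real_derivative
      std_normal_density (ig_arg \<delta> \<gamma> x t) * (\<gamma> / (2 * sqrt t) + \<delta> * x / (2 * (t * sqrt t)))
      + exp (2 * \<delta> * \<gamma> * x) * (std_normal_density (ig_arg \<delta> (- \<gamma>) x t)
          * (- \<gamma> / (2 * sqrt t) + \<delta> * x / (2 * (t * sqrt t))))) (at t)"
    unfolding ig_cdf_def[abs_def]
    by (intro DERIV_add DERIV_cmult DERIV_chain'[where g = std_normal_cdf]
          ig_arg_has_derivative_time std_normal_cdf_has_derivative assms)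
  also have "exp (2 * \<delta> * \<gamma> * x) * (std_normal_density (ig_arg \<delta> (- \<gamma>) x t)
          * (- \<gamma> / (2 * sqrt t) + \<delta> * x / (2 * (t * sqrt t))))
      = std_normal_density (ig_arg \<delta> \<gamma> x t) * (- \<gamma> / (2 * sqrt t) + \<delta> * x / (2 * (t * sqrt t)))"
    unfolding ig_gauss_reflect[OF assms, of \<delta> \<gamma> x, symmetric] by (simp only: mult.assoc)
  finally show ?thesis
    by (rule DERIV_cong) (simp add: ig_density_def flip: distrib_left)
qed

lemma exp_reflect_has_derivative_space:
  assumes "t > 0"
  shows "((\<lambda>x. exp (2 * \<delta> * \<gamma> * x) * std_normal_cdf (ig_arg \<delta> (- \<gamma>) x t)) has_real_derivative
      2 * \<delta> * \<gamma> * (exp (2 * \<delta> * \<gamma> * x) * std_normal_cdf (ig_arg \<delta> (- \<gamma>) x t))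
      - \<delta> / sqrt t * std_normal_density (ig_arg \<delta> \<gamma> x t)) (at x)"
proof -
  have "((\<lambda>x. exp (2 * \<delta> * \<gamma> * x)) has_real_derivative exp (2 * \<delta> * \<gamma> * x) * (2 * \<delta> * \<gamma>)) (at x)"
    by (auto intro!: derivative_eq_intros)
  then have "((\<lambda>x. exp (2 * \<delta> * \<gamma> * x) * std_normal_cdf (ig_arg \<delta> (- \<gamma>) x t)) has_real_derivative
      exp (2 * \<delta> * \<gamma> * x) * (2 * \<delta> * \<gamma>) * std_normal_cdf (ig_arg \<delta> (- \<gamma>) x t)
      + std_normal_density (ig_arg \<delta> (- \<gamma>) x t) * (- \<delta> / sqrt t) * exp (2 * \<delta> * \<gamma> * x)) (at x)"
    by (intro DERIV_mult DERIV_chain'[where g = std_normal_cdf]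
          ig_arg_has_derivative_space std_normal_cdf_has_derivative assms)
  then show ?thesis
    by (rule DERIV_cong) (simp add: ig_gauss_reflect[OF assms, of \<delta> \<gamma> x, symmetric] algebra_simps)
qed

lemma ig_cdf_has_derivative_space:
  assumes "t > 0"
  shows "((\<lambda>x. ig_cdf \<delta> \<gamma> x t) has_real_derivative - ig_exit_density \<delta> \<gamma> x t) (at x)"
proof -
  have "((\<lambda>x. ig_cdf \<delta> \<gamma> x t) has_real_derivative
      std_normal_density (ig_arg \<delta> \<gamma> x t) * (- \<delta> / sqrt t)
      + (2 * \<delta> * \<gamma> * (exp (2 * \<delta> * \<gamma> * x) * std_normal_cdf (ig_arg \<delta> (- \<gamma>) x t))
         - \<delta> / sqrt t * std_normal_density (ig_arg \<delta> \<gamma> x t))) (at x)"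
    unfolding ig_cdf_def[abs_def]
    by (intro DERIV_add DERIV_chain'[where g = std_normal_cdf] exp_reflect_has_derivative_space
          ig_arg_has_derivative_space std_normal_cdf_has_derivative assms)
  then show ?thesis
    by (rule DERIV_cong) (simp add: ig_exit_density_def)
qed

lemma std_normal_density_has_derivative:
  "(std_normal_density has_real_derivative - x * std_normal_density x) (at x)"
  unfolding std_normal_density_def[abs_def]
  by (auto intro!: derivative_eq_intros simp: field_simps)

text \<open>Since \<^term>\<open>ig_exit_density \<delta> \<gamma>\<close> is minus the space derivative of \<^term>\<open>ig_cdf \<delta> \<gamma>\<close>, this is the
  equation \<open>2 \<delta>\<^sup>2 F\<^sub>t = F\<^sub>x\<^sub>x - 2 \<delta> \<gamma> F\<^sub>x\<close> for \<open>F = ig_cdf \<delta> \<gamma>\<close>.\<close>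

lemma ig_exit_density_has_derivative_space:
  assumes "t > 0"
  shows "((\<lambda>x. ig_exit_density \<delta> \<gamma> x t) has_real_derivative
      2 * \<delta> * \<gamma> * ig_exit_density \<delta> \<gamma> x t - 2 * \<delta>\<^sup>2 * ig_density \<delta> \<gamma> x t) (at x)"
proof -
  let ?p = "std_normal_density (ig_arg \<delta> \<gamma> x t)"
  let ?E = "exp (2 * \<delta> * \<gamma> * x) * std_normal_cdf (ig_arg \<delta> (- \<gamma>) x t)"
  have "- ig_arg \<delta> \<gamma> x t * (- \<delta> / sqrt t) = \<delta> * (\<gamma> * t - \<delta> * x) / t"
    using assms by (simp add: ig_arg_def)
  also have "\<dots> = \<delta> * \<gamma> - \<delta> * (\<delta> * x / t)"
    using assms by (simp add: field_simps)
  finally have a: "- ig_arg \<delta> \<gamma> x t * (- \<delta> / sqrt t) = \<delta> * \<gamma> - \<delta> * (\<delta> * x / t)" .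
  have "2 * \<delta> / sqrt t * (- ig_arg \<delta> \<gamma> x t * ?p * (- \<delta> / sqrt t))
      = 2 * \<delta> / sqrt t * ?p * (- ig_arg \<delta> \<gamma> x t * (- \<delta> / sqrt t))"
    by (simp only: mult_ac)
  also have "\<dots> = 2 * \<delta>\<^sup>2 * \<gamma> / sqrt t * ?p - 2 * \<delta>\<^sup>2 * ig_density \<delta> \<gamma> x t"
    unfolding a ig_density_def
    by (simp add: algebra_simps power2_eq_square add_divide_distrib diff_divide_distrib)
  finally have b: "2 * \<delta> / sqrt t * (- ig_arg \<delta> \<gamma> x t * ?p * (- \<delta> / sqrt t))
      = 2 * \<delta>\<^sup>2 * \<gamma> / sqrt t * ?p - 2 * \<delta>\<^sup>2 * ig_density \<delta> \<gamma> x t" .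
  have "((\<lambda>x. ig_exit_density \<delta> \<gamma> x t) has_real_derivative
      2 * \<delta> / sqrt t * (- ig_arg \<delta> \<gamma> x t * ?p * (- \<delta> / sqrt t))
      - 2 * \<delta> * \<gamma> * (2 * \<delta> * \<gamma> * ?E - \<delta> / sqrt t * ?p)) (at x)"
    unfolding ig_exit_density_def[abs_def]
    by (intro DERIV_diff DERIV_cmult exp_reflect_has_derivative_space assms
          DERIV_chain'[OF ig_arg_has_derivative_space std_normal_density_has_derivative])
  then show ?thesis
    unfolding b by (rule DERIV_cong) (simp add: ig_exit_density_def algebra_simps power2_eq_square)
qed

text \<open>For a nonnegative integrand the finite limits of a primitive bound the integrals over
  all compact subintervals, so integrability is a conclusion here. \<open>FTC_Ioi\<close> serves
  integrands of varying sign and takes it as a premise.\<close>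

lemma FTC_Ioi_nonneg:
  fixes f F :: "real \<Rightarrow> real"
  assumes "\<And>x. 0 < x \<Longrightarrow> (F has_real_derivative f x) (at x)"
    and "\<And>x. 0 < x \<Longrightarrow> isCont f x" and "\<And>x. 0 < x \<Longrightarrow> 0 \<le> f x"
    and "(F \<longlongrightarrow> A) (at_right 0)" and "(F \<longlongrightarrow> B) at_top"
  shows "set_integrable lborel {0<..} f" and "(LINT x:{0<..}|lborel. f x) = B - A"
proof -
  have *: "einterval 0 \<infinity> = {0::real<..}"
    by (auto simp: einterval_def)
  note ftc = interval_integral_FTC_nonneg[where a = 0 and b = \<infinity> and f = f and F = F and A = A and B = B]
  show "set_integrable lborel {0<..} f"
    unfolding *[symmetric]
    by (rule ftc(1)) (use assms in \<open>auto simp: ereal_tendsto_simps zero_ereal_def intro: AE_I2\<close>)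
  show "(LINT x:{0<..}|lborel. f x) = B - A"
    unfolding interval_integral_to_infinity_eq[of _ 0, unfolded zero_ereal_def[symmetric], symmetric]
    by (rule ftc(2)) (use assms in \<open>auto simp: ereal_tendsto_simps zero_ereal_def intro: AE_I2\<close>)
qed

lemma FTC_Ioi:
  fixes f F :: "real \<Rightarrow> real"
  assumes "\<And>x. 0 < x \<Longrightarrow> (F has_real_derivative f x) (at x)"
    and "\<And>x. 0 < x \<Longrightarrow> isCont f x" and "set_integrable lborel {0<..} f"
    and "(F \<longlongrightarrow> A) (at_right 0)" and "(F \<longlongrightarrow> B) at_top"
  shows "(LINT x:{0<..}|lborel. f x) = B - A"
proof -
  have *: "einterval 0 \<infinity> = {0::real<..}"
    by (auto simp: einterval_def)
  show ?thesis
    unfolding interval_integral_to_infinity_eq[of _ 0, unfolded zero_ereal_def[symmetric], symmetric]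
    by (rule interval_integral_FTC_integrable[where F = F])
       (use assms in \<open>auto simp: ereal_tendsto_simps zero_ereal_def * 
          has_real_derivative_iff_has_vector_derivative[symmetric]\<close>)
qed

lemma FTC_Ioc_nonneg:
  fixes f F :: "real \<Rightarrow> real"
  assumes "0 < T" and "\<And>x. 0 < x \<Longrightarrow> (F has_real_derivative f x) (at x)"
    and "\<And>x. 0 < x \<Longrightarrow> isCont f x" and "\<And>x. 0 < x \<Longrightarrow> 0 \<le> f x"
    and "(F \<longlongrightarrow> A) (at_right 0)"
  shows "set_integrable lborel {0<..T} f" and "(LINT x:{0<..T}|lborel. f x) = F T - A"
proof -
  have *: "einterval 0 (ereal T) = {0<..<T}"
    by (auto simp: einterval_def)
  have FT: "(F \<longlongrightarrow> F T) (at_left T)"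
    using DERIV_isCont[OF assms(2)[OF assms(1)]] by (simp add: isCont_def filterlim_at_split)
  note ftc = interval_integral_FTC_nonneg[where a = 0 and b = "ereal T" and f = f and F = F and A = A and B = "F T"]
  have 1: "set_integrable lborel {0<..<T} f"
    unfolding *[symmetric]
    by (rule ftc(1)) (use assms FT in \<open>auto simp: ereal_tendsto_simps zero_ereal_def intro: AE_I2\<close>)
  have "(LBINT x=0..T. f x) = F T - A"
    by (rule ftc(2)) (use assms FT in \<open>auto simp: ereal_tendsto_simps zero_ereal_def intro: AE_I2\<close>)
  then have 2: "(LINT x:{0<..<T}|lborel. f x) = F T - A"
    using assms(1) by (simp add: interval_lebesgue_integral_def * zero_ereal_def)
  \<comment> \<open>The limit theorem yields the open interval; the null point \<open>T\<close> is
    added so that the result matches a distribution function at \<open>T\<close>.\<close>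
  have eq: "{0<..T} = {0<..<T} \<union> {T}" using assms(1) by auto
  have T: "(\<lambda>x. indicator {T} x *\<^sub>R f x) = (\<lambda>x. f T * indicator {T} x)"
    by (auto simp: indicator_def)
  have 3: "set_integrable lborel {T} f" "(LINT x:{T}|lborel. f x) = 0"
    unfolding set_integrable_def set_lebesgue_integral_def T by auto
  show "set_integrable lborel {0<..T} f"
    unfolding eq using 1 3 by (intro set_integrable_Un) auto
  have "(LINT x:{0<..T}|lborel. f x) = (LINT x:{0<..<T}|lborel. f x)"
    unfolding eq using 1 3 by (subst set_integral_Un) auto
  then show "(LINT x:{0<..T}|lborel. f x) = F T - A" using 2 by simp
qed

section \<open>Total mass, Laplace transform and decay of the inverse Gaussian law\<close>

lemma isCont_ig_density_time: "t > 0 \<Longrightarrow> isCont (\<lambda>t. ig_density \<delta> \<gamma> x t) t"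
  unfolding ig_density_def ig_arg_def
  by (intro continuous_intros isCont_o2[OF _ isCont_std_normal_density]) auto

lemma isCont_ig_density_space: "t > 0 \<Longrightarrow> isCont (\<lambda>x. ig_density \<delta> \<gamma> x t) x"
  unfolding ig_density_def ig_arg_def
  by (intro continuous_intros isCont_o2[OF _ isCont_std_normal_density]) auto

lemma ig_cdf_at_right_0:
  assumes "\<delta> > 0" "x > 0"
  shows "(ig_cdf \<delta> \<gamma> x \<longlongrightarrow> 0) (at_right 0)"
proof -
  \<comment> \<open>Near time 0 the term - \<delta> x / sqrt t dominates whatever the drift, so the
    direct and the reflected argument both fall to minus infinity.\<close>
  have "filterlim (ig_arg \<delta> g x) at_bot (at_right 0)" for g
  proof -
    have "\<delta> * x > 0" using assms by simp
    then show ?thesis unfolding ig_arg_def[abs_def] by real_asymp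
  qed
  then have "(ig_cdf \<delta> \<gamma> x \<longlongrightarrow> 0 + exp (2 * \<delta> * \<gamma> * x) * 0) (at_right 0)"
    unfolding ig_cdf_def[abs_def]
    by (intro tendsto_intros filterlim_compose[OF std_normal_cdf_at_bot])
  then show ?thesis by simp
qed

lemma ig_cdf_at_top_time:
  assumes "\<gamma> > 0"
  shows "(ig_cdf \<delta> \<gamma> x \<longlongrightarrow> 1) at_top"
proof -
  have 1: "filterlim (ig_arg \<delta> \<gamma> x) at_top at_top"
    unfolding ig_arg_def[abs_def] using assms by real_asymp
  have 2: "filterlim (ig_arg \<delta> (- \<gamma>) x) at_bot at_top"
    unfolding ig_arg_def[abs_def] using assms by real_asymp
  have "(ig_cdf \<delta> \<gamma> x \<longlongrightarrow> 1 + exp (2 * \<delta> * \<gamma> * x) * 0) at_top"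
    unfolding ig_cdf_def[abs_def]
    by (intro tendsto_intros filterlim_compose[OF std_normal_cdf_at_bot 2]
          filterlim_compose[OF std_normal_cdf_at_top 1])
  then show ?thesis by simp
qed

lemma ig_density_integrable_time:
  assumes "\<delta> > 0" "\<gamma> > 0" "x > 0"
  shows "set_integrable lborel {0<..} (ig_density \<delta> \<gamma> x)"
    and "(LINT t:{0<..}|lborel. ig_density \<delta> \<gamma> x t) = 1"
proof -
  note ftc = FTC_Ioi_nonneg[where F = "ig_cdf \<delta> \<gamma> x" and f = "ig_density \<delta> \<gamma> x" and A = 0 and B = 1]
  show "set_integrable lborel {0<..} (ig_density \<delta> \<gamma> x)"
    by (rule ftc(1)) (use assms in \<open>auto intro: ig_cdf_has_derivative_time isCont_ig_density_time
        ig_density_nonneg ig_cdf_at_right_0 ig_cdf_at_top_time\<close>)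
  have "(LINT t:{0<..}|lborel. ig_density \<delta> \<gamma> x t) = 1 - 0"
    by (rule ftc(2)) (use assms in \<open>auto intro: ig_cdf_has_derivative_time isCont_ig_density_time
        ig_density_nonneg ig_cdf_at_right_0 ig_cdf_at_top_time\<close>)
  then show "(LINT t:{0<..}|lborel. ig_density \<delta> \<gamma> x t) = 1" by simp
qed

lemma ig_cdf_eq_integral:
  assumes "\<delta> > 0" "x > 0" "T > 0"
  shows "set_integrable lborel {0<..T} (ig_density \<delta> \<gamma> x)"
    and "(LINT t:{0<..T}|lborel. ig_density \<delta> \<gamma> x t) = ig_cdf \<delta> \<gamma> x T"
proof -
  note ftc = FTC_Ioc_nonneg[where F = "ig_cdf \<delta> \<gamma> x" and f = "ig_density \<delta> \<gamma> x" and A = 0 and T = T]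
  show "set_integrable lborel {0<..T} (ig_density \<delta> \<gamma> x)"
    by (rule ftc(1)) (use assms in \<open>auto intro: ig_cdf_has_derivative_time isCont_ig_density_time
        ig_density_nonneg ig_cdf_at_right_0\<close>)
  have "(LINT t:{0<..T}|lborel. ig_density \<delta> \<gamma> x t) = ig_cdf \<delta> \<gamma> x T - 0"
    by (rule ftc(2)) (use assms in \<open>auto intro: ig_cdf_has_derivative_time isCont_ig_density_time
        ig_density_nonneg ig_cdf_at_right_0\<close>)
  then show "(LINT t:{0<..T}|lborel. ig_density \<delta> \<gamma> x t) = ig_cdf \<delta> \<gamma> x T" by simp
qed

text \<open>\<gamma>' is the drift with (\<gamma>'^2 - \<gamma>^2) / 2 = s, so the tilt between the
  two Gaussian factors contains exactly exp(-s t).\<close>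

lemma ig_density_tilt:
  fixes \<delta> \<gamma> s t x :: real
  assumes "t > 0" "s \<ge> 0"
  defines "\<gamma>' \<equiv> sqrt (2 * s + \<gamma>\<^sup>2)"
  shows "exp (- s * t) * ig_density \<delta> \<gamma> x t
    = exp (- x * (\<delta> * (\<gamma>' - \<gamma>))) * ig_density \<delta> \<gamma>' x t"
proof -
  have sq: "\<gamma>'\<^sup>2 = 2 * s + \<gamma>\<^sup>2" using assms by (simp add: \<gamma>'_def)
  have "- s * t = - x * (\<delta> * (\<gamma>' - \<gamma>)) + (- (2 * s + \<gamma>\<^sup>2 - \<gamma>\<^sup>2) / 2 * t + \<delta> * (\<gamma>' - \<gamma>) * x)"
    by (simp add: algebra_simps)
  then have "exp (- s * t) = exp (- x * (\<delta> * (\<gamma>' - \<gamma>)))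
      * exp (- (2 * s + \<gamma>\<^sup>2 - \<gamma>\<^sup>2) / 2 * t + \<delta> * (\<gamma>' - \<gamma>) * x)"
    by (simp only: exp_add)
  then show ?thesis
    unfolding ig_density_def ig_gauss_tilt[OF assms(1), of \<delta> \<gamma>' x \<gamma>] sq
    by (simp only: mult.assoc)
qed

text \<open>The tilt leaves a factor free of t in front of an inverse Gaussian density with another
  drift, whose total mass is 1.\<close>

lemma ig_density_laplace:
  assumes "\<delta> > 0" "\<gamma> > 0" "x > 0" "s \<ge> 0"
  shows "set_integrable lborel {0<..} (\<lambda>t. exp (- s * t) * ig_density \<delta> \<gamma> x t)"
    and "(LINT t:{0<..}|lborel. exp (- s * t) * ig_density \<delta> \<gamma> x t)
      = exp (- x * (\<delta> * (sqrt (2 * s + \<gamma>\<^sup>2) - \<gamma>)))"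
proof -
  define \<gamma>' where "\<gamma>' = sqrt (2 * s + \<gamma>\<^sup>2)"
  have \<gamma>': "\<gamma>' > 0" using assms by (simp add: \<gamma>'_def add_nonneg_pos)
  have eq: "exp (- s * t) * ig_density \<delta> \<gamma> x t
    = exp (- x * (\<delta> * (\<gamma>' - \<gamma>))) * ig_density \<delta> \<gamma>' x t" if "t \<in> {0<..}" for t
    using ig_density_tilt[of t s \<delta> \<gamma> x] assms that by (simp add: \<gamma>'_def)
  show "set_integrable lborel {0<..} (\<lambda>t. exp (- s * t) * ig_density \<delta> \<gamma> x t)"
    by (subst set_integrable_cong[OF refl refl eq])
       (auto intro!: set_integrable_mult_right ig_density_integrable_time assms \<gamma>')
  have "(LINT t:{0<..}|lborel. exp (- s * t) * ig_density \<delta> \<gamma> x t)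
     = (LINT t:{0<..}|lborel. exp (- x * (\<delta> * (\<gamma>' - \<gamma>))) * ig_density \<delta> \<gamma>' x t)"
    by (rule set_lebesgue_integral_cong) (use eq in auto)
  also have "\<dots> = exp (- x * (\<delta> * (\<gamma>' - \<gamma>)))"
    by (simp add: set_integral_mult_right ig_density_integrable_time assms \<gamma>')
  finally show "(LINT t:{0<..}|lborel. exp (- s * t) * ig_density \<delta> \<gamma> x t)
      = exp (- x * (\<delta> * (sqrt (2 * s + \<gamma>\<^sup>2) - \<gamma>)))" by (simp add: \<gamma>'_def)
qed

text \<open>exp(T - t) \<ge> 1 for t \<le> T, and the Laplace transform at 1 decays exponentially in
  x. This decay provides the limits and the integrability in space.\<close>

lemma ig_cdf_chernoff:
  assumes "\<delta> > 0" "\<gamma> > 0" "x > 0" "T > 0"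
  shows "ig_cdf \<delta> \<gamma> x T \<le> exp T * exp (- x * (\<delta> * (sqrt (2 + \<gamma>\<^sup>2) - \<gamma>)))"
proof -
  have "ig_cdf \<delta> \<gamma> x T = (LINT t:{0<..T}|lborel. ig_density \<delta> \<gamma> x t)"
    using ig_cdf_eq_integral assms by simp
  also have "\<dots> \<le> (LINT t:{0<..}|lborel. exp T * (exp (- 1 * t) * ig_density \<delta> \<gamma> x t))"
    unfolding set_lebesgue_integral_def
  proof (rule integral_mono)
    show "integrable lborel (\<lambda>t. indicator {0<..T} t *\<^sub>R ig_density \<delta> \<gamma> x t)"
      using ig_cdf_eq_integral(1)[of \<delta> x T \<gamma>] assms by (simp add: set_integrable_def)
    show "integrable lborel (\<lambda>t. indicator {0<..} t *\<^sub>R (exp T * (exp (- 1 * t) * ig_density \<delta> \<gamma> x t)))"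
      using set_integrable_mult_right[OF ig_density_laplace(1)[of \<delta> \<gamma> x 1], of "exp T"] assms
      by (simp add: set_integrable_def)
    fix t :: real
    have "ig_density \<delta> \<gamma> x t \<le> exp T * (exp (- 1 * t) * ig_density \<delta> \<gamma> x t)" if "0 < t" "t \<le> T"
    proof -
      have "1 * ig_density \<delta> \<gamma> x t \<le> exp (T - t) * ig_density \<delta> \<gamma> x t"
        using that assms by (intro mult_right_mono ig_density_nonneg) auto
      then show ?thesis by (simp add: exp_diff exp_minus field_simps)
    qed
    then show "indicator {0<..T} t *\<^sub>R ig_density \<delta> \<gamma> x t
      \<le> indicator {0<..} t *\<^sub>R (exp T * (exp (- 1 * t) * ig_density \<delta> \<gamma> x t))"
      using assms by (auto simp: indicator_def intro!: mult_nonneg_nonneg ig_density_nonneg)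
  qed
  also have "\<dots> = exp T * exp (- x * (\<delta> * (sqrt (2 + \<gamma>\<^sup>2) - \<gamma>)))"
    by (subst set_integral_mult_right) (use ig_density_laplace(2)[of \<delta> \<gamma> x 1] assms in simp)
  finally show ?thesis .
qed

lemma ig_rate_pos:
  assumes "\<delta> > 0"
  shows "0 < \<delta> * (sqrt (2 + \<gamma>\<^sup>2) - \<gamma>)"
proof -
  have "sqrt (\<gamma>\<^sup>2) < sqrt (2 + \<gamma>\<^sup>2)" by (intro real_sqrt_less_mono) simp
  then show ?thesis using assms by simp
qed

lemma ig_cdf_at_top_space:
  assumes "\<delta> > 0" "\<gamma> > 0" "t > 0"
  shows "((\<lambda>x. ig_cdf \<delta> \<gamma> x t) \<longlongrightarrow> 0) at_top"
proof (rule tendsto_sandwich[OF _ _ tendsto_const])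
  define c where "c = \<delta> * (sqrt (2 + \<gamma>\<^sup>2) - \<gamma>)"
  have c: "c > 0" unfolding c_def using assms by (intro ig_rate_pos)
  show "((\<lambda>x. exp t * exp (- x * c)) \<longlongrightarrow> 0) at_top"
    using c by real_asymp
  show "\<forall>\<^sub>F x in at_top. ig_cdf \<delta> \<gamma> x t \<le> exp t * exp (- x * c)"
    unfolding c_def using eventually_gt_at_top[of 0]
    by eventually_elim (intro ig_cdf_chernoff assms)
qed (simp add: ig_cdf_nonneg)

lemma isCont_ig_cdf_space: "t > 0 \<Longrightarrow> isCont (\<lambda>x. ig_cdf \<delta> \<gamma> x t) x"
  using DERIV_isCont ig_cdf_has_derivative_space by blast

lemma set_integrable_exp_neg:
  assumes "c > 0"
  shows "set_integrable lborel {0<..} (\<lambda>x::real. exp (- x * c))"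
proof (rule FTC_Ioi_nonneg(1)[where F = "\<lambda>x. - exp (- x * c) / c"])
  show "((\<lambda>x. - exp (- x * c) / c) \<longlongrightarrow> 0) at_top" using assms by real_asymp
  show "((\<lambda>x. - exp (- x * c) / c) \<longlongrightarrow> - exp (- 0 * c) / c) (at_right 0)"
    by (intro tendsto_intros) (use assms in auto)
qed (use assms in \<open>auto intro!: derivative_eq_intros continuous_intros\<close>)

lemma ig_cdf_integrable_space:
  assumes "\<delta> > 0" "\<gamma> > 0" "t > 0"
  shows "set_integrable lborel {0<..} (\<lambda>x. ig_cdf \<delta> \<gamma> x t)"
proof (rule set_integrable_bound)
  show "set_integrable lborel {0<..} (\<lambda>x. exp t * exp (- x * (\<delta> * (sqrt (2 + \<gamma>\<^sup>2) - \<gamma>))))"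
    by (intro set_integrable_mult_right set_integrable_exp_neg ig_rate_pos assms)
  show "set_borel_measurable lborel {0<..} (\<lambda>x. ig_cdf \<delta> \<gamma> x t)"
    unfolding set_borel_measurable_def by measurable
  show "AE x in lborel. x \<in> {0<..} \<longrightarrow>
      norm (ig_cdf \<delta> \<gamma> x t) \<le> norm (exp t * exp (- x * (\<delta> * (sqrt (2 + \<gamma>\<^sup>2) - \<gamma>))))"
    using ig_cdf_chernoff[of \<delta> \<gamma> _ t] assms by (auto simp: ig_cdf_nonneg intro!: AE_I2)
qed

lemma ig_exit_density_at_top:
  assumes "\<delta> > 0" "\<gamma> > 0" "t > 0"
  shows "((\<lambda>x. ig_exit_density \<delta> \<gamma> x t) \<longlongrightarrow> 0) at_top"
proof -
  have "((\<lambda>x. std_normal_density (ig_arg \<delta> \<gamma> x t)) \<longlongrightarrow> 0) at_top"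
  proof (rule filterlim_compose[where f = "\<lambda>x. ig_arg \<delta> \<gamma> x t"])
    show "filterlim (\<lambda>x. ig_arg \<delta> \<gamma> x t) at_bot at_top"
      unfolding ig_arg_def using assms by real_asymp
    show "(std_normal_density \<longlongrightarrow> 0) at_bot"
      unfolding std_normal_density_def[abs_def] by real_asymp
  qed
  \<comment> \<open>The growing exponential times the normal tail is a summand of
    \<open>ig_cdf\<close>, and the other summand is nonnegative, so the decay of
    \<open>ig_cdf\<close> squeezes the product to 0.\<close>
  moreover have "((\<lambda>x. exp (2 * \<delta> * \<gamma> * x) * std_normal_cdf (ig_arg \<delta> (- \<gamma>) x t)) \<longlongrightarrow> 0) at_top"
    by (rule tendsto_sandwich[OF _ _ tendsto_const ig_cdf_at_top_space[OF assms]])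
       (auto simp: ig_cdf_def std_normal_cdf_nonneg)
  ultimately have "((\<lambda>x. ig_exit_density \<delta> \<gamma> x t) \<longlongrightarrow>
      2 * \<delta> / sqrt t * 0 - 2 * \<delta> * \<gamma> * 0) at_top"
    unfolding ig_exit_density_def by (intro tendsto_diff tendsto_mult_left)
  then show ?thesis by simp
qed

lemma ig_cdf_zero: "t > 0 \<Longrightarrow> ig_cdf \<delta> \<gamma> 0 t = 1"
proof -
  have "ig_arg \<delta> (- \<gamma>) 0 t = - ig_arg \<delta> \<gamma> 0 t" by (simp add: ig_arg_def)
  then show ?thesis by (simp add: ig_cdf_def std_normal_cdf_minus)
qed

text \<open>The equation for \<open>ig_cdf\<close> makes 2 \<delta>^2 \<open>ig_density\<close> the
  exact x-derivative of the function \<open>F\<close> below, which has finite limits at both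
  ends.\<close>

lemma ig_density_integrable_space:
  assumes "\<delta> > 0" "\<gamma> > 0" "t > 0"
  shows "set_integrable lborel {0<..} (\<lambda>x. ig_density \<delta> \<gamma> x t)"
proof -
  define F where "F x = - ig_exit_density \<delta> \<gamma> x t - 2 * \<delta> * \<gamma> * ig_cdf \<delta> \<gamma> x t" for x
  have "set_integrable lborel {0<..} (\<lambda>x. 2 * \<delta>\<^sup>2 * ig_density \<delta> \<gamma> x t)"
  proof (rule FTC_Ioi_nonneg(1)[where F = F])
    show "(F has_real_derivative 2 * \<delta>\<^sup>2 * ig_density \<delta> \<gamma> x t) (at x)" for x
      unfolding F_def[abs_def]
      by (rule DERIV_cong[OF DERIV_diff[OF DERIV_minus[OF ig_exit_density_has_derivative_space]
              DERIV_cmult[OF ig_cdf_has_derivative_space]]])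
         (use assms in \<open>auto simp: algebra_simps\<close>)
    then have "isCont F 0" using DERIV_isCont by blast
    then show "(F \<longlongrightarrow> F 0) (at_right 0)" by (simp add: isCont_def filterlim_at_split)
    show "(F \<longlongrightarrow> - 0 - 2 * \<delta> * \<gamma> * 0) at_top"
      unfolding F_def[abs_def]
      by (intro tendsto_diff tendsto_minus tendsto_mult_left ig_exit_density_at_top ig_cdf_at_top_space assms)
  qed (use assms in \<open>auto intro!: continuous_intros isCont_ig_density_space mult_nonneg_nonneg ig_density_nonneg\<close>)
  from set_integrable_mult_right[OF this, of "1 / (2 * \<delta>\<^sup>2)"] show ?thesis
    using assms by simp
qed

section \<open>Integration by parts in space, and exchange of integrals\<close>

lemma set_integrable_mult_bounded:
  fixes f q :: "real \<Rightarrow> real"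
  assumes f: "set_integrable lborel A f" and [measurable]: "A \<in> sets borel" "q \<in> borel_measurable borel"
    and B: "\<And>x. x \<in> A \<Longrightarrow> \<bar>q x\<bar> \<le> B"
  shows "set_integrable lborel A (\<lambda>x. q x * f x)"
  unfolding set_integrable_def
proof (rule Bochner_Integration.integrable_bound)
  show "integrable lborel (\<lambda>x. B * (indicator A x *\<^sub>R f x))"
    using f by (simp add: set_integrable_def)
  have m: "(\<lambda>x. indicator A x *\<^sub>R f x) \<in> borel_measurable borel"
    using f by (auto simp: set_integrable_def dest: borel_measurable_integrable)
  have "(\<lambda>x. q x * (indicator A x *\<^sub>R f x)) \<in> borel_measurable lborel"
    using m by measurable
  then show "(\<lambda>x. indicator A x *\<^sub>R (q x * f x)) \<in> borel_measurable lborel"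
    by (simp add: mult.left_commute)
  show "AE x in lborel. norm (indicator A x *\<^sub>R (q x * f x)) \<le> norm (B * (indicator A x *\<^sub>R f x))"
  proof (rule AE_I2)
    fix x
    have "\<bar>q x\<bar> * \<bar>f x\<bar> \<le> \<bar>B\<bar> * \<bar>f x\<bar>" if "x \<in> A"
      using B[OF that] by (intro mult_right_mono) auto
    then show "norm (indicator A x *\<^sub>R (q x * f x)) \<le> norm (B * (indicator A x *\<^sub>R f x))"
      by (auto simp: indicator_def abs_mult)
  qed
qed

text \<open>Two integrations by parts in the space variable, using the equation satisfied by
  \<^const>\<open>ig_cdf\<close>.\<close>

lemma ig_density_space_integral:
  assumes par: "\<delta> > 0" "\<gamma> > 0" "t > 0"
    and q: "\<And>x. (q has_real_derivative q1 x) (at x)" "\<And>x. (q1 has_real_derivative q2 x) (at x)"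
      "\<And>x. isCont q2 x"
    and B: "\<And>x. 0 < x \<Longrightarrow> \<bar>q x\<bar> \<le> B" "\<And>x. 0 < x \<Longrightarrow> \<bar>q1 x\<bar> \<le> B" "\<And>x. 0 < x \<Longrightarrow> \<bar>q2 x\<bar> \<le> B"
  shows "2 * \<delta>\<^sup>2 * (LINT x:{0<..}|lborel. q x * ig_density \<delta> \<gamma> x t) =
      (LINT x:{0<..}|lborel. q2 x * ig_cdf \<delta> \<gamma> x t)
      + 2 * \<delta> * \<gamma> * (LINT x:{0<..}|lborel. q1 x * ig_cdf \<delta> \<gamma> x t)
      + ig_exit_density \<delta> \<gamma> 0 t * q 0 + 2 * \<delta> * \<gamma> * q 0 + q1 0"
proof -
  let ?F = "\<lambda>x. ig_cdf \<delta> \<gamma> x t" and ?g = "\<lambda>x. ig_density \<delta> \<gamma> x t" and ?h = "\<lambda>x. ig_exit_density \<delta> \<gamma> x t"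
  \<comment> \<open>Both integrations by parts in one primitive: in its derivative \<open>D\<close>
    all terms with \<open>ig_exit_density\<close> cancel, and its value at 0 collects the boundary
    terms.\<close>
  define A where "A x = - (q x * ?h x) - 2 * \<delta> * \<gamma> * (q x * ?F x) - q1 x * ?F x" for x
  have c: "isCont q x" "isCont q1 x" for x using q DERIV_isCont by blast+
  have m[measurable]: "q \<in> borel_measurable borel" "q1 \<in> borel_measurable borel" "q2 \<in> borel_measurable borel"
    using c q(3) by (auto intro!: borel_measurable_continuous_onI continuous_at_imp_continuous_on)
  have i: "set_integrable lborel {0<..} (\<lambda>x. q x * ?g x)" "set_integrable lborel {0<..} (\<lambda>x. q1 x * ?F x)"
    "set_integrable lborel {0<..} (\<lambda>x. q2 x * ?F x)"
    by (rule set_integrable_mult_bounded[where B = B], use B par in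
        \<open>auto intro!: ig_density_integrable_space ig_cdf_integrable_space\<close>)+
  have bt: "((\<lambda>x. r x * s x) \<longlongrightarrow> 0) at_top"
    if r: "\<And>x. 0 < x \<Longrightarrow> \<bar>r x\<bar> \<le> B" and s: "(s \<longlongrightarrow> 0) at_top" for r s :: "real \<Rightarrow> real"
  proof (rule Lim_null_comparison)
    show "\<forall>\<^sub>F x in at_top. norm (r x * s x) \<le> B * \<bar>s x\<bar>"
      using eventually_gt_at_top[of 0]
      by eventually_elim (auto simp: abs_mult intro!: mult_right_mono r)
    show "((\<lambda>x. B * \<bar>s x\<bar>) \<longlongrightarrow> 0) at_top"
      using tendsto_mult_left[OF tendsto_rabs[OF s], of B] by simp
  qed
  have D: "(A has_real_derivative 2 * \<delta>\<^sup>2 * (q x * ?g x) - 2 * \<delta> * \<gamma> * (q1 x * ?F x) - q2 x * ?F x) (at x)" for x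
  proof -
    note h = ig_exit_density_has_derivative_space[OF par(3), of \<delta> \<gamma> x]
      and F = ig_cdf_has_derivative_space[OF par(3), of \<delta> \<gamma> x]
    have "(A has_real_derivative
       - (q1 x * ?h x + (2 * \<delta> * \<gamma> * ?h x - 2 * \<delta>\<^sup>2 * ?g x) * q x)
       - 2 * \<delta> * \<gamma> * (q1 x * ?F x + (- ?h x) * q x) - (q2 x * ?F x + (- ?h x) * q1 x)) (at x)"
      unfolding A_def[abs_def] by (intro DERIV_diff DERIV_minus DERIV_mult DERIV_cmult q h F)
    then show ?thesis by (rule DERIV_cong) (simp add: algebra_simps)
  qed
  have "(LINT x:{0<..}|lborel. 2 * \<delta>\<^sup>2 * (q x * ?g x) - 2 * \<delta> * \<gamma> * (q1 x * ?F x) - q2 x * ?F x)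
      = (- 0 - 2 * \<delta> * \<gamma> * 0 - 0) - A 0"
  proof (rule FTC_Ioi[where F = A])
    show "(A \<longlongrightarrow> A 0) (at_right 0)"
      using DERIV_isCont[OF D[of 0]] by (simp add: isCont_def filterlim_at_split)
    show "(A \<longlongrightarrow> - 0 - 2 * \<delta> * \<gamma> * 0 - 0) at_top"
      unfolding A_def[abs_def]
      by (intro tendsto_diff tendsto_minus tendsto_mult_left bt B
            ig_exit_density_at_top ig_cdf_at_top_space par)
    show "set_integrable lborel {0<..}
        (\<lambda>x. 2 * \<delta>\<^sup>2 * (q x * ?g x) - 2 * \<delta> * \<gamma> * (q1 x * ?F x) - q2 x * ?F x)"
      by (intro set_integral_diff set_integrable_mult_right i)
    show "isCont (\<lambda>x. 2 * \<delta>\<^sup>2 * (q x * ?g x) - 2 * \<delta> * \<gamma> * (q1 x * ?F x) - q2 x * ?F x) x" for x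
      by (intro continuous_intros c q isCont_ig_density_space isCont_ig_cdf_space par)
  qed (rule D)
  moreover have "(LINT x:{0<..}|lborel. 2 * \<delta>\<^sup>2 * (q x * ?g x) - 2 * \<delta> * \<gamma> * (q1 x * ?F x) - q2 x * ?F x)
     = 2 * \<delta>\<^sup>2 * (LINT x:{0<..}|lborel. q x * ?g x)
       - 2 * \<delta> * \<gamma> * (LINT x:{0<..}|lborel. q1 x * ?F x) - (LINT x:{0<..}|lborel. q2 x * ?F x)"
    by (simp add: set_integral_diff set_integrable_mult_right i set_integral_mult_right)
  ultimately show ?thesis
    using par by (simp add: A_def ig_cdf_zero algebra_simps)
qed

text \<open>\<open>ig_cdf\<close> is the time integral of \<open>ig_density\<close>, so exchanging
  integrals presents the space integral at \<open>T\<close> as a primitive in \<open>T\<close>.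
  Fubini applies since the absolute values integrate over time to |q| times \<open>ig_cdf\<close>,
  which is integrable in space.\<close>

lemma ig_space_time_Fubini:
  assumes par: "\<delta> > 0" "\<gamma> > 0" "T > 0"
    and [measurable]: "q \<in> borel_measurable borel" and B: "\<And>x. 0 < x \<Longrightarrow> \<bar>q x\<bar> \<le> B"
  shows "set_integrable lborel {0<..T} (\<lambda>u. LINT x:{0<..}|lborel. q x * ig_density \<delta> \<gamma> x u)"
    and "(LINT x:{0<..}|lborel. q x * ig_cdf \<delta> \<gamma> x T)
      = (LINT u:{0<..T}|lborel. LINT x:{0<..}|lborel. q x * ig_density \<delta> \<gamma> x u)"
proof -
  define f where "f x u = indicator {0<..} x * q x * (indicator {0<..T} u * ig_density \<delta> \<gamma> x u)" for x u
  have fm[measurable]: "case_prod f \<in> borel_measurable (lborel \<Otimes>\<^sub>M lborel)"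
    unfolding f_def by measurable
  have ix: "integrable lborel (\<lambda>u. f x u)" for x
  proof (cases "x > 0")
    case True
    then show ?thesis using ig_cdf_eq_integral(1)[of \<delta> x T \<gamma>] par
      by (auto simp: f_def set_integrable_def)
  qed (simp add: f_def)
  have int_u: "(\<integral>u. f x u \<partial>lborel) = indicator {0<..} x * (q x * ig_cdf \<delta> \<gamma> x T)" for x
  proof (cases "x > 0")
    case True
    then show ?thesis using ig_cdf_eq_integral(2)[of \<delta> x T \<gamma>] par
      by (simp add: f_def set_lebesgue_integral_def)
  qed (simp add: f_def)
  have int_norm: "(\<integral>u. norm (f x u) \<partial>lborel) = indicator {0<..} x * (\<bar>q x\<bar> * ig_cdf \<delta> \<gamma> x T)" for x
  proof (cases "x > 0")
    case True
    have "norm (f x u) = \<bar>q x\<bar> * (indicator {0<..T} u * ig_density \<delta> \<gamma> x u)" for u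
      using True par by (auto simp: f_def abs_mult indicator_def ig_density_nonneg)
    then show ?thesis using ig_cdf_eq_integral(2)[of \<delta> x T \<gamma>] par True
      by (simp add: set_lebesgue_integral_def)
  qed (simp add: f_def)
  have "set_integrable lborel {0<..} (\<lambda>x. \<bar>q x\<bar> * ig_cdf \<delta> \<gamma> x T)"
    by (rule set_integrable_mult_bounded[where B = B])
       (use B par in \<open>auto intro!: ig_cdf_integrable_space\<close>)
  then have I: "integrable (lborel \<Otimes>\<^sub>M lborel) (case_prod f)"
    by (intro lborel_pair.Fubini_integrable) (auto simp: int_norm[unfolded real_norm_def] set_integrable_def ix)
  have s: "(\<integral>x. f x u \<partial>lborel) = indicator {0<..T} u * (LINT x:{0<..}|lborel. q x * ig_density \<delta> \<gamma> x u)" for u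
  proof -
    have "f x u = indicator {0<..T} u * (indicator {0<..} x * (q x * ig_density \<delta> \<gamma> x u))" for x
      by (simp add: f_def mult_ac)
    then show ?thesis by (simp add: set_lebesgue_integral_def)
  qed
  show "set_integrable lborel {0<..T} (\<lambda>u. LINT x:{0<..}|lborel. q x * ig_density \<delta> \<gamma> x u)"
    using lborel_pair.integrable_snd[OF I] by (simp add: s set_integrable_def)
  show "(LINT x:{0<..}|lborel. q x * ig_cdf \<delta> \<gamma> x T)
      = (LINT u:{0<..T}|lborel. LINT x:{0<..}|lborel. q x * ig_density \<delta> \<gamma> x u)"
    using lborel_pair.Fubini_integral[OF I] by (simp add: s int_u set_lebesgue_integral_def)
qed

text \<open>Fubini applied to q(X) - q(0), the integral of \<open>q1\<close> over (0, X];
  boundedness of \<open>q1\<close> and the integrable tail justify the exchange.\<close>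

lemma (in prob_space) expectation_by_tail:
  fixes X :: "'a \<Rightarrow> real"
  assumes [measurable]: "random_variable borel X" and nn: "\<And>\<omega>. \<omega> \<in> space M \<Longrightarrow> 0 \<le> X \<omega>"
    and q: "\<And>x. (q has_real_derivative q1 x) (at x)" "\<And>x. isCont q1 x"
    and B: "\<And>x. 0 < x \<Longrightarrow> \<bar>q1 x\<bar> \<le> B"
    and tail: "set_integrable lborel {0<..} (\<lambda>x. \<P>(\<omega> in M. x \<le> X \<omega>))"
  shows "integrable M (\<lambda>\<omega>. q (X \<omega>))"
    and "expectation (\<lambda>\<omega>. q (X \<omega>)) = q 0 + (LINT x:{0<..}|lborel. q1 x * \<P>(\<omega> in M. x \<le> X \<omega>))"
proof -
  have [measurable]: "q1 \<in> borel_measurable borel"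
    using q(2) by (auto intro!: borel_measurable_continuous_onI continuous_at_imp_continuous_on)
  define f where "f x \<omega> = indicator {0<..} x * q1 x * (if x \<le> X \<omega> then 1 else 0)" for x \<omega>
  have fm[measurable]: "case_prod f \<in> borel_measurable (lborel \<Otimes>\<^sub>M M)"
    unfolding f_def by measurable
  have ind: "(\<integral>\<omega>. (if x \<le> X \<omega> then 1 else 0) \<partial>M) = \<P>(\<omega> in M. x \<le> X \<omega>)" for x
  proof -
    have "(\<integral>\<omega>. (if x \<le> X \<omega> then 1 else 0) \<partial>M) = (\<integral>\<omega>. indicator {\<omega> \<in> space M. x \<le> X \<omega>} \<omega> \<partial>M)"
      by (intro Bochner_Integration.integral_cong) (auto simp: indicator_def)
    also have "\<dots> = \<P>(\<omega> in M. x \<le> X \<omega>)" by simp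
    finally show ?thesis .
  qed
  have int_w: "(\<integral>\<omega>. f x \<omega> \<partial>M) = indicator {0<..} x * (q1 x * \<P>(\<omega> in M. x \<le> X \<omega>))" for x
    by (simp add: f_def ind)
  have nf: "norm (f x \<omega>) = indicator {0<..} x * \<bar>q1 x\<bar> * (if x \<le> X \<omega> then 1 else 0)" for x \<omega>
    by (simp add: f_def abs_mult)
  have int_norm: "(\<integral>\<omega>. norm (f x \<omega>) \<partial>M) = indicator {0<..} x * (\<bar>q1 x\<bar> * \<P>(\<omega> in M. x \<le> X \<omega>))" for x
    unfolding nf by (simp add: ind)
  have ix: "integrable M (\<lambda>\<omega>. f x \<omega>)" for x
    unfolding f_def by (intro integrable_mult_right integrable_const_bound[where B = 1]) auto
  interpret L: pair_sigma_finite lborel M ..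
  have "set_integrable lborel {0<..} (\<lambda>x. \<bar>q1 x\<bar> * \<P>(\<omega> in M. x \<le> X \<omega>))"
    by (rule set_integrable_mult_bounded[where B = B]) (use B tail in auto)
  then have I: "integrable (lborel \<Otimes>\<^sub>M M) (case_prod f)"
    by (intro L.Fubini_integrable) (auto simp: int_norm[unfolded real_norm_def] set_integrable_def ix)
  have s: "(\<integral>x. f x \<omega> \<partial>lborel) = q (X \<omega>) - q 0" if "\<omega> \<in> space M" for \<omega>
  proof -
    have "(\<integral>x. f x \<omega> \<partial>lborel) = (\<integral>x. q1 x * indicator {0..X \<omega>} x \<partial>lborel)"
      by (rule integral_cong_AE)
         (use AE_lborel_singleton[of "0::real"] in \<open>auto elim!: eventually_mono simp: f_def indicator_def\<close>)
    also have "\<dots> = q (X \<omega>) - q 0"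
      by (rule integral_FTC_Icc_real) (use nn that q in auto)
    finally show ?thesis .
  qed
  have "integrable M (\<lambda>\<omega>. q (X \<omega>) - q 0)"
    using L.integrable_snd[OF I] by (subst (asm) Bochner_Integration.integrable_cong[OF refl s]) auto
  from Bochner_Integration.integrable_add[OF this integrable_const[of "q 0"]]
  show i: "integrable M (\<lambda>\<omega>. q (X \<omega>))" by simp
  have "(\<integral>\<omega>. (\<integral>x. f x \<omega> \<partial>lborel) \<partial>M) = (\<integral>\<omega>. q (X \<omega>) - q 0 \<partial>M)"
    by (rule Bochner_Integration.integral_cong) (auto simp: s)
  also have "\<dots> = expectation (\<lambda>\<omega>. q (X \<omega>)) - q 0"
    using i by (simp add: prob_space)
  finally show "expectation (\<lambda>\<omega>. q (X \<omega>)) = q 0 + (LINT x:{0<..}|lborel. q1 x * \<P>(\<omega> in M. x \<le> X \<omega>))"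
    using L.Fubini_integral[OF I] by (simp add: int_w set_lebesgue_integral_def)
qed

section \<open>The inverse Gaussian subordinator and its exit times\<close>

definition ig_measure :: "real \<Rightarrow> real \<Rightarrow> real \<Rightarrow> real measure" where
  "ig_measure \<delta> \<gamma> x = density lborel (\<lambda>t. ennreal (indicator {0<..} t * ig_density \<delta> \<gamma> x t))"

lemma real_distribution_ig_measure:
  assumes "\<delta> > 0" "\<gamma> > 0" "x > 0"
  shows "real_distribution (ig_measure \<delta> \<gamma> x)"
proof -
  have "prob_space (ig_measure \<delta> \<gamma> x)"
  proof (rule prob_spaceI)
    have i: "integrable lborel (\<lambda>t. indicator {0<..} t * ig_density \<delta> \<gamma> x t)"
      using ig_density_integrable_time(1)[of \<delta> \<gamma> x] assms by (simp add: set_integrable_def)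
    have "emeasure (ig_measure \<delta> \<gamma> x) (space (ig_measure \<delta> \<gamma> x))
        = (\<integral>\<^sup>+t. ennreal (indicator {0<..} t * ig_density \<delta> \<gamma> x t) \<partial>lborel)"
      by (simp add: ig_measure_def emeasure_density)
    also have "\<dots> = ennreal (\<integral>t. indicator {0<..} t * ig_density \<delta> \<gamma> x t \<partial>lborel)"
      by (rule nn_integral_eq_integral[OF i])
         (use assms in \<open>auto simp: indicator_def ig_density_nonneg\<close>)
    also have "\<dots> = 1"
      using ig_density_integrable_time(2)[of \<delta> \<gamma> x] assms by (simp add: set_lebesgue_integral_def)
    finally show "emeasure (ig_measure \<delta> \<gamma> x) (space (ig_measure \<delta> \<gamma> x)) = 1" .
  qed
  then show ?thesis
    by (simp add: real_distribution_def real_distribution_axioms_def ig_measure_def)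
qed

lemma AE_ig_measure_pos: "AE t in ig_measure \<delta> \<gamma> x. 0 < t"
  unfolding ig_measure_def by (subst AE_density) (auto simp: indicator_def intro!: AE_I2)

lemma integral_ig_measure:
  assumes "\<delta> > 0" "x > 0" and [measurable]: "f \<in> borel_measurable borel"
  shows "(\<integral>t. f t \<partial>ig_measure \<delta> \<gamma> x) = (LINT t:{0<..}|lborel. f t * ig_density \<delta> \<gamma> x t)"
  unfolding ig_measure_def set_lebesgue_integral_def
  by (subst integral_density)
     (use assms in \<open>auto simp: indicator_def ig_density_nonneg mult_ac intro!: Bochner_Integration.integral_cong\<close>)

lemma cdf_ig_measure:
  assumes "\<delta> > 0" "\<gamma> > 0" "x > 0" "t > 0"
  shows "cdf (ig_measure \<delta> \<gamma> x) t = ig_cdf \<delta> \<gamma> x t"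
proof -
  interpret real_distribution "ig_measure \<delta> \<gamma> x"
    using assms by (intro real_distribution_ig_measure)
  have "cdf (ig_measure \<delta> \<gamma> x) t = (\<integral>s. indicator {..t} s \<partial>ig_measure \<delta> \<gamma> x)"
    by (simp add: cdf_def)
  also have "\<dots> = (LINT s:{0<..}|lborel. indicator {..t} s * ig_density \<delta> \<gamma> x s)"
    by (rule integral_ig_measure) (use assms in auto)
  also have "\<dots> = (LINT s:{0<..t}|lborel. ig_density \<delta> \<gamma> x s)"
    unfolding set_lebesgue_integral_def
    by (intro Bochner_Integration.integral_cong) (auto simp: indicator_def)
  finally show ?thesis using ig_cdf_eq_integral(2) assms by simp
qed

lemma inverse_gaussian_subordinator_nonneg:
  assumes "inverse_gaussian_subordinator M \<delta> \<gamma> G" "x \<ge> 0"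
  shows "AE \<omega> in M. 0 \<le> G x \<omega>"
proof -
  have z: "AE \<omega> in M. G 0 \<omega> = 0" and m: "\<forall>\<omega>\<in>space M. mono_on {0..} (\<lambda>t. G t \<omega>)"
    using assms by (auto simp: inverse_gaussian_subordinator_def levy_process_def)
  from z AE_space show ?thesis
  proof eventually_elim
    case (elim \<omega>)
    then have "G 0 \<omega> \<le> G x \<omega>"
      using m assms(2) by (intro mono_onD[of "{0..}" "\<lambda>t. G t \<omega>"]) auto
    with elim show ?case by simp
  qed
qed

text \<open>Both laws live on the nonnegative half-line, and at the integers the prescribed Laplace
  transform is the one computed for \<open>ig_density\<close>. At time 0 the law is a point mass,
  hence x > 0.\<close>

lemma distr_inverse_gaussian_subordinator:
  assumes par: "\<delta> > 0" "\<gamma> > 0" "x > 0" and G: "inverse_gaussian_subordinator M \<delta> \<gamma> G"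
  shows "distr M borel (G x) = ig_measure \<delta> \<gamma> x"
proof (rule laplace_transform_unique)
  have levy: "levy_process M G" and lap: "\<forall>t\<ge>0. \<forall>s\<ge>0. prob_space.expectation M (\<lambda>\<omega>. exp (- s * G t \<omega>)) =
                       exp (- t * (\<delta> * (sqrt (2 * s + \<gamma>\<^sup>2) - \<gamma>)))"
    using G by (auto simp: inverse_gaussian_subordinator_def)
  interpret prob_space M using levy by (simp add: levy_process_def)
  have [measurable]: "G x \<in> borel_measurable M"
    using levy par by (simp add: levy_process_def)
  show "real_distribution (distr M borel (G x))"
    by (rule real_distribution_distr) measurable
  show "AE y in distr M borel (G x). 0 \<le> y"
    by (subst AE_distr_iff) (use inverse_gaussian_subordinator_nonneg[OF G] par in auto)
  show "real_distribution (ig_measure \<delta> \<gamma> x)"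
    using par by (intro real_distribution_ig_measure)
  show "AE y in ig_measure \<delta> \<gamma> x. 0 \<le> y"
    by (rule AE_mp[OF AE_ig_measure_pos]) auto
  fix n :: nat
  have "(\<integral>y. exp (- real n * y) \<partial>distr M borel (G x)) = (\<integral>\<omega>. exp (- real n * G x \<omega>) \<partial>M)"
    by (rule integral_distr) auto
  also have "\<dots> = exp (- x * (\<delta> * (sqrt (2 * real n + \<gamma>\<^sup>2) - \<gamma>)))"
    using lap par by simp
  also have "\<dots> = (\<integral>y. exp (- real n * y) \<partial>ig_measure \<delta> \<gamma> x)"
    by (subst integral_ig_measure) (use par ig_density_laplace(2)[of \<delta> \<gamma> x "real n"] in auto)
  finally show "(\<integral>y. exp (- real n * y) \<partial>distr M borel (G x)) = (\<integral>y. exp (- real n * y) \<partial>ig_measure \<delta> \<gamma> x)" .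
qed

lemma inverse_gaussian_subordinator_cdf:
  assumes "\<delta> > 0" "\<gamma> > 0" "x > 0" "t > 0" and G: "inverse_gaussian_subordinator M \<delta> \<gamma> G"
  shows "\<P>(\<omega> in M. G x \<omega> \<le> t) = ig_cdf \<delta> \<gamma> x t"
proof -
  have [measurable]: "G x \<in> borel_measurable M"
    using G assms by (simp add: inverse_gaussian_subordinator_def levy_process_def)
  have "cdf (distr M borel (G x)) t = \<P>(\<omega> in M. G x \<omega> \<le> t)"
    unfolding cdf_def by (subst measure_distr) (auto simp: vimage_def Int_def conj_commute)
  then show ?thesis
    using distr_inverse_gaussian_subordinator[OF assms(1-3) G] cdf_ig_measure assms by simp
qed

lemma first_exit_time_nonneg: "0 \<le> first_exit_time G t \<omega>"
  unfolding first_exit_time_def by (auto intro!: cInf_greatest)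

lemma first_exit_time_le: "r \<ge> 0 \<Longrightarrow> G r \<omega> > t \<Longrightarrow> first_exit_time G t \<omega> \<le> r"
  unfolding first_exit_time_def by (auto intro!: cInf_lower bdd_belowI[of _ 0])

text \<open>By monotonicity every time at which \<open>G\<close> exceeds t lies beyond x; the last
  premise excludes the default value 0 of the exit time.\<close>

lemma first_exit_time_ge:
  assumes "mono_on {0..} (\<lambda>t. G t \<omega>)" "x \<ge> 0" "G x \<omega> \<le> t" "\<exists>r\<ge>0. G r \<omega> > t"
  shows "x \<le> first_exit_time G t \<omega>"
proof -
  have "x \<le> Inf {r. 0 \<le> r \<and> G r \<omega> > t}"
  proof (rule cInf_greatest)
    fix r assume "r \<in> {r. 0 \<le> r \<and> G r \<omega> > t}"
    then show "x \<le> r"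
      using mono_onD[OF assms(1), of r x] assms(2,3) by (cases "r \<le> x") auto
  qed (use assms(4) in auto)
  then show ?thesis using assms(4) by (simp add: first_exit_time_def)
qed

text \<open>At each positive time the law of \<open>G\<close> charges only positive values, so
  almost surely \<open>G\<close> is positive at all times 1/(n+1) and exceeds level 0 at
  once.\<close>

lemma first_exit_time_0:
  assumes par: "\<delta> > 0" "\<gamma> > 0" and G: "inverse_gaussian_subordinator M \<delta> \<gamma> G"
  shows "AE \<omega> in M. first_exit_time G 0 \<omega> = 0"
proof -
  have "AE \<omega> in M. 0 < G (1 / Suc n) \<omega>" for n
  proof -
    have [measurable]: "G (1 / Suc n) \<in> borel_measurable M"
      using G by (simp add: inverse_gaussian_subordinator_def levy_process_def)
    have "AE y in distr M borel (G (1 / Suc n)). 0 < y"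
      by (subst distr_inverse_gaussian_subordinator[OF par _ G]) (auto intro: AE_ig_measure_pos)
    then show ?thesis by (subst (asm) AE_distr_iff) (auto simp del: of_nat_Suc)
  qed
  then have "AE \<omega> in M. \<forall>n. 0 < G (1 / Suc n) \<omega>" by (simp add: AE_all_countable)
  then show ?thesis
  proof eventually_elim
    case (elim \<omega>)
    have "first_exit_time G 0 \<omega> \<le> 1 / Suc n" for n
      using elim by (intro first_exit_time_le) auto
    then have "first_exit_time G 0 \<omega> \<le> 0"
      by (intro LIMSEQ_le_const[OF LIMSEQ_inverse_real_of_nat]) (auto simp: inverse_eq_divide)
    then show ?case using first_exit_time_nonneg[of G 0 \<omega>] by linarith
  qed
qed

text \<open>The events that the exit time is at least x and that \<open>G x\<close> is at most t can
  differ in two ways. If \<open>G x\<close> exceeds t, the exit time is at most x, so they differ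
  only where it equals x, which \<open>atom\<close> makes null. If \<open>G\<close> never exceeds t,
  the exit time is the default 0; this is null too.\<close>

lemma first_exit_time_tail:
  assumes par: "\<delta> > 0" "\<gamma> > 0" "t > 0" "x > 0" and G: "inverse_gaussian_subordinator M \<delta> \<gamma> G"
    and E[measurable]: "first_exit_time G t \<in> borel_measurable M"
    and atom: "AE \<omega> in M. first_exit_time G t \<omega> \<noteq> x"
  shows "\<P>(\<omega> in M. x \<le> first_exit_time G t \<omega>) = ig_cdf \<delta> \<gamma> x t"
proof -
  have levy: "levy_process M G" and mono: "\<And>\<omega>. \<omega>\<in>space M \<Longrightarrow> mono_on {0..} (\<lambda>t. G t \<omega>)"
    using G by (auto simp: inverse_gaussian_subordinator_def)
  interpret prob_space M using levy by (simp add: levy_process_def)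
  have Gm[measurable]: "G y \<in> borel_measurable M" if "y \<ge> 0" for y
    using levy that by (simp add: levy_process_def)
  \<comment> \<open>The event that \<open>G\<close> stays at or below t at all positive integer
    times has probability at most \<open>ig_cdf\<close> at each of them, which tends to 0.
    \<open>Suc\<close> keeps the times positive, where the law of \<open>G\<close> is known.\<close>
  have "AE \<omega> in M. \<exists>n. G (real (Suc n)) \<omega> > t"
  proof (rule AE_I)
    show "{\<omega> \<in> space M. \<not> (\<exists>n. G (real (Suc n)) \<omega> > t)} \<subseteq> (\<Inter>n. {\<omega> \<in> space M. G (real (Suc n)) \<omega> \<le> t})"
      by (auto simp: not_less)
    show sets: "(\<Inter>n. {\<omega> \<in> space M. G (real (Suc n)) \<omega> \<le> t}) \<in> events"
      by (intro sets.countable_INT) auto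
    have "prob (\<Inter>n. {\<omega> \<in> space M. G (real (Suc n)) \<omega> \<le> t}) \<le> ig_cdf \<delta> \<gamma> (real (Suc m)) t" for m
      by (subst inverse_gaussian_subordinator_cdf[OF par(1,2) _ par(3) G, symmetric])
         (auto intro!: finite_measure_mono simp del: of_nat_Suc)
    moreover have "(\<lambda>m. ig_cdf \<delta> \<gamma> (real (Suc m)) t) \<longlonglongrightarrow> 0"
      by (rule filterlim_compose[OF ig_cdf_at_top_space[OF par(1-3)]])
         (rule filterlim_compose[OF filterlim_real_sequentially filterlim_Suc])
    ultimately have "prob (\<Inter>n. {\<omega> \<in> space M. G (real (Suc n)) \<omega> \<le> t}) \<le> 0"
      by (intro LIMSEQ_le_const) auto
    then show "emeasure M (\<Inter>n. {\<omega> \<in> space M. G (real (Suc n)) \<omega> \<le> t}) = 0"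
      by (simp add: emeasure_eq_measure measure_le_0_iff)
  qed
  with atom have "AE \<omega> in M. \<omega> \<in> {\<omega> \<in> space M. x \<le> first_exit_time G t \<omega>}
      \<longleftrightarrow> \<omega> \<in> {\<omega> \<in> space M. G x \<omega> \<le> t}"
  proof (eventually_elim, safe)
    fix \<omega> n assume *: "\<omega> \<in> space M" "first_exit_time G t \<omega> \<noteq> x" "t < G (real (Suc n)) \<omega>"
    show "G x \<omega> \<le> t" if "x \<le> first_exit_time G t \<omega>"
      using that * first_exit_time_le[of x t G \<omega>] par by (cases "G x \<omega> \<le> t") auto
    show "x \<le> first_exit_time G t \<omega>" if "G x \<omega> \<le> t"
      by (rule first_exit_time_ge[of G \<omega>, OF mono[OF *(1)]]) (use that * par in \<open>auto intro!: exI[of _ "real (Suc n)"]\<close>)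
  qed
  then have "\<P>(\<omega> in M. x \<le> first_exit_time G t \<omega>) = \<P>(\<omega> in M. G x \<omega> \<le> t)"
    using par by (intro finite_measure_eq_AE) auto
  then show ?thesis using inverse_gaussian_subordinator_cdf[OF par(1,2,4,3) G] by simp
qed

section \<open>The Poisson process of order k\<close>

text \<open>For k \<ge> 1, the law of a sum of n independent uniform jumps, by conditioning on one
  of them. This recursion is the source of the shifted sums in the forward equations.\<close>

fun uniform_sum_prob :: "nat \<Rightarrow> nat \<Rightarrow> nat \<Rightarrow> real" where
  "uniform_sum_prob k 0 m = (if m = 0 then 1 else 0)"
| "uniform_sum_prob k (Suc n) m = (\<Sum>j = 1..min m k. uniform_sum_prob k n (m - j)) / real k"

text \<open>Every jump is at least 1. Hence only finitely many jump counts contribute to a given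
  m.\<close>

lemma uniform_sum_prob_eq_0: "m < n \<Longrightarrow> uniform_sum_prob k n m = 0"
proof (induction n arbitrary: m)
  case (Suc n)
  have "uniform_sum_prob k n (m - j) = 0" if "j \<in> {1..min m k}" for j
    using that Suc.prems by (intro Suc.IH) auto
  then show ?case by simp
qed simp

text \<open>A formula valid for every real x, so that derivatives at 0 are two-sided.\<close>

definition poisson_weight :: "real \<Rightarrow> nat \<Rightarrow> real \<Rightarrow> real" where
  "poisson_weight \<mu> n x = (\<mu> * x) ^ n / fact n * exp (- (\<mu> * x))"

lemma poisson_weight_has_derivative:
  "(poisson_weight \<mu> n has_real_derivative
     \<mu> * ((if n = 0 then 0 else poisson_weight \<mu> (n - 1) x) - poisson_weight \<mu> n x)) (at x)"
proof (cases n)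
  case 0
  then show ?thesis unfolding poisson_weight_def[abs_def]
    by (auto intro!: derivative_eq_intros)
next
  case (Suc l)
  have "((\<lambda>x. (\<mu> * x) ^ Suc l / fact (Suc l)) has_real_derivative
      real (Suc l) * (\<mu> * x) ^ l * \<mu> / fact (Suc l)) (at x)"
    by (rule DERIV_cdivide[OF DERIV_cong[OF DERIV_power[OF DERIV_cmult[OF DERIV_ident]]]]) simp
  also have "real (Suc l) * (\<mu> * x) ^ l * \<mu> / fact (Suc l) = \<mu> * ((\<mu> * x) ^ l / fact l)"
    unfolding fact_Suc by (simp add: field_simps del: of_nat_Suc)
  finally have 1: "((\<lambda>x. (\<mu> * x) ^ Suc l / fact (Suc l)) has_real_derivative
      \<mu> * ((\<mu> * x) ^ l / fact l)) (at x)" .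
  have 2: "((\<lambda>x. exp (- (\<mu> * x))) has_real_derivative exp (- (\<mu> * x)) * (- \<mu>)) (at x)"
    by (auto intro!: derivative_eq_intros)
  have "(poisson_weight \<mu> (Suc l) has_real_derivative
     \<mu> * ((\<mu> * x) ^ l / fact l) * exp (- (\<mu> * x))
     + exp (- (\<mu> * x)) * (- \<mu>) * ((\<mu> * x) ^ Suc l / fact (Suc l))) (at x)"
    unfolding poisson_weight_def[abs_def] by (rule DERIV_mult[OF 1 2])
  then show ?thesis
    unfolding Suc by (rule DERIV_cong) (simp add: poisson_weight_def right_diff_distrib mult_ac del: fact_Suc power_Suc)
qed

text \<open>The mixture over the number n of Poisson jumps, cut off at m because n jumps add up to
  at least n; a finite sum can be differentiated termwise.\<close>

definition ppok_pmf :: "nat \<Rightarrow> real \<Rightarrow> nat \<Rightarrow> real \<Rightarrow> real" where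
  "ppok_pmf k lam m x = (\<Sum>n\<le>m. poisson_weight (real k * lam) n x * uniform_sum_prob k n m)"

text \<open>The right-hand side of Kolmogorov's forward equations as an operator on families indexed
  by m. Its square produces the first integrand of the theorem.\<close>

definition ppok_generator :: "nat \<Rightarrow> real \<Rightarrow> (nat \<Rightarrow> real \<Rightarrow> real) \<Rightarrow> nat \<Rightarrow> real \<Rightarrow> real" where
  "ppok_generator k lam u m x = - (real k * lam) * u m x + lam * (\<Sum>j = 1..min m k. u (m - j) x)"

text \<open>The operator is linear with coefficients free of x, so it commutes with d/dx, and
  iterating it yields the higher derivatives of \<open>ppok_pmf\<close>.\<close>

lemma ppok_generator_has_derivative:
  assumes "\<And>m x. (u m has_real_derivative u' m x) (at x)"
  shows "(ppok_generator k lam u m has_real_derivative ppok_generator k lam u' m x) (at x)"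
  unfolding ppok_generator_def[abs_def]
  by (intro DERIV_add DERIV_cmult DERIV_sum assms)

text \<open>The term for leaving m and the at most k terms for arriving there contribute k lam B
  each in total.\<close>

lemma ppok_generator_bounded:
  assumes "lam > 0" and B: "\<And>m. \<bar>u m x\<bar> \<le> B"
  shows "\<bar>ppok_generator k lam u m x\<bar> \<le> 2 * real k * lam * B"
proof -
  have B0: "0 \<le> B" using B[of 0] by linarith
  have "\<bar>\<Sum>j = 1..min m k. u (m - j) x\<bar> \<le> (\<Sum>j = 1..min m k. \<bar>u (m - j) x\<bar>)"
    by (rule sum_abs)
  also have "\<dots> \<le> of_nat (card {1..min m k}) * B"
    by (rule sum_bounded_above) (rule B)
  also have "\<dots> \<le> real k * B" using B0 by (intro mult_right_mono) auto
  finally have "lam * \<bar>\<Sum>j = 1..min m k. u (m - j) x\<bar> \<le> lam * (real k * B)"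
    using assms(1) by (intro mult_left_mono) auto
  moreover have "(real k * lam) * \<bar>u m x\<bar> \<le> (real k * lam) * B"
    using assms(1) B by (intro mult_left_mono) auto
  moreover have "\<bar>ppok_generator k lam u m x\<bar> \<le> (real k * lam) * \<bar>u m x\<bar> + lam * \<bar>\<Sum>j = 1..min m k. u (m - j) x\<bar>"
    unfolding ppok_generator_def using abs_triangle_ineq[of "- (real k * lam) * u m x" "lam * (\<Sum>j = 1..min m k. u (m - j) x)"] assms(1)
    by (simp add: abs_mult)
  ultimately show ?thesis by (simp add: algebra_simps)
qed

lemma ppok_generator_twice:
  "ppok_generator k lam (ppok_generator k lam u) m x = (real k * lam)\<^sup>2 * u m x
     - 2 * real k * lam\<^sup>2 * (\<Sum>j = 1..min m k. u (m - j) x)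
     + lam\<^sup>2 * (\<Sum>j = 1..min m k. \<Sum>i = 1..min (m - j) k. u (m - j - i) x)"
proof -
  have "(\<Sum>j = 1..min m k. ppok_generator k lam u (m - j) x)
      = - (real k * lam) * (\<Sum>j = 1..min m k. u (m - j) x)
        + lam * (\<Sum>j = 1..min m k. \<Sum>i = 1..min (m - j) k. u (m - j - i) x)"
    unfolding ppok_generator_def by (simp add: sum.distrib sum_distrib_left sum_negf sum_subtractf)
  moreover have "ppok_generator k lam (ppok_generator k lam u) m x = - (real k * lam) * ppok_generator k lam u m x
      + lam * (\<Sum>j = 1..min m k. ppok_generator k lam u (m - j) x)"
    by (rule ppok_generator_def)
  ultimately show ?thesis
    by (simp only: ppok_generator_def[of k lam u m]) (simp add: algebra_simps power2_eq_square)
qed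

text \<open>Differentiating a Poisson weight lowers the jump count by one; after an index shift, the
  recursion for one more jump turns this into the shifts m - j.\<close>

lemma ppok_pmf_has_derivative:
  assumes "k \<ge> 1"
  shows "(ppok_pmf k lam m has_real_derivative ppok_generator k lam (ppok_pmf k lam) m x) (at x)"
proof -
  define w where "w = poisson_weight (real k * lam)"
  define c where "c = uniform_sum_prob k"
  have "(ppok_pmf k lam m has_real_derivative
      (\<Sum>n\<le>m. (real k * lam) * ((if n = 0 then 0 else w (n - 1) x) - w n x) * c n m)) (at x)"
    unfolding ppok_pmf_def[abs_def] w_def c_def
    by (intro DERIV_sum DERIV_cmult_right poisson_weight_has_derivative)
  moreover have "(\<Sum>n\<le>m. (real k * lam) * ((if n = 0 then 0 else w (n - 1) x) - w n x) * c n m)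
      = real k * lam * (\<Sum>n\<le>m. (if n = 0 then 0 else w (n - 1) x) * c n m) - real k * lam * ppok_pmf k lam m x"
    by (simp add: ppok_pmf_def w_def c_def sum_distrib_left sum_subtractf algebra_simps)
  moreover have "(\<Sum>n\<le>m. (if n = 0 then 0 else w (n - 1) x) * c n m) = (\<Sum>n<m. w n x * c (Suc n) m)"
    by (subst lessThan_Suc_atMost[symmetric], subst sum.lessThan_Suc_shift) simp
  moreover have "(\<Sum>n<m. w n x * c (Suc n) m)
      = (\<Sum>j = 1..min m k. (\<Sum>n<m. w n x * c n (m - j))) / real k"
    unfolding c_def by (subst sum.swap) (simp add: sum_distrib_left sum_divide_distrib)
  \<comment> \<open>Since j \<ge> 1, the range up to m - j lies below m; the surplus terms vanish
    because n jumps exceed m - j.\<close>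
  moreover have "(\<Sum>n<m. w n x * c n (m - j)) = ppok_pmf k lam (m - j) x" if "j \<in> {1..min m k}" for j
    unfolding ppok_pmf_def w_def c_def
    by (rule sum.mono_neutral_right) (use that in \<open>auto simp: uniform_sum_prob_eq_0\<close>)
  ultimately have "(ppok_pmf k lam m has_real_derivative
     real k * lam * ((\<Sum>j = 1..min m k. ppok_pmf k lam (m - j) x) / real k)
     - real k * lam * ppok_pmf k lam m x) (at x)" by simp
  then show ?thesis
    by (rule DERIV_cong) (use assms in \<open>simp add: ppok_generator_def\<close>)
qed

lemma ppok_pmf_0: "ppok_pmf k lam m 0 = (if m = 0 then 1 else 0)"
proof -
  have "ppok_pmf k lam m 0 = (\<Sum>n\<le>m. if n = 0 then uniform_sum_prob k 0 m else 0)"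
    unfolding ppok_pmf_def by (intro sum.cong) (auto simp: poisson_weight_def)
  then show ?thesis by simp
qed

lemma ppok_generator_ppok_pmf_0:
  "ppok_generator k lam (ppok_pmf k lam) m 0
    = (if m = 0 then - real k * lam else if m \<le> k then lam else 0)"
proof -
  have "(\<Sum>j = 1..min m k. ppok_pmf k lam (m - j) 0) = (\<Sum>j \<in> {1..min m k}. if j = m then 1 else 0)"
    by (intro sum.cong) (auto simp: ppok_pmf_0)
  also have "\<dots> = (if m \<noteq> 0 \<and> m \<le> k then 1 else 0)" by auto
  finally show ?thesis by (auto simp: ppok_generator_def ppok_pmf_0)
qed

lemma (in prob_space) prob_uniform_sum:
  fixes X :: "nat \<Rightarrow> 'a \<Rightarrow> nat"
  assumes "k \<ge> 1"
    and indep: "indep_vars (\<lambda>_. count_space UNIV) X {1..}"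
    and unif: "\<And>i. i \<ge> 1 \<Longrightarrow> distr M (count_space UNIV) (X i) = measure_pmf (pmf_of_set {1..k})"
  shows "\<P>(\<omega> in M. (\<Sum>i = 1..n. X i \<omega>) = m) = uniform_sum_prob k n m"
proof (induction n arbitrary: m)
  case 0
  then show ?case by (simp add: prob_space)
next
  case (Suc n)
  have Xm[measurable]: "X i \<in> measurable M (count_space UNIV)" if "i \<ge> 1" for i
    using indep that by (auto simp: indep_vars_def)
  have Sm[measurable]: "(\<lambda>\<omega>. \<Sum>i = 1..n. X i \<omega>) \<in> measurable M (count_space UNIV)" for n
    by (intro measurable_sum_nat) auto
  have pX: "\<P>(\<omega> in M. X (Suc n) \<omega> = j) = (if j \<in> {1..k} then 1 / real k else 0)" for j
  proof -
    have "\<P>(\<omega> in M. X (Suc n) \<omega> = j) = measure (distr M (count_space UNIV) (X (Suc n))) {j}"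
      by (subst measure_distr) (auto intro!: arg_cong[where f = prob])
    also have "\<dots> = pmf (pmf_of_set {1..k}) j" by (simp add: unif pmf.rep_eq)
    finally show ?thesis using assms(1) by (subst (asm) pmf_of_set) (auto simp: indicator_def)
  qed
  \<comment> \<open>Independence of the new jump from the sum of the old ones is taken over the
    reals; \<open>joint\<close> returns to natural numbers through singletons.\<close>
  have iv: "indep_var borel (\<lambda>\<omega>. real (X (Suc n) \<omega>)) borel (\<lambda>\<omega>. \<Sum>i\<in>{1..n}. real (X i \<omega>))"
  proof (rule indep_vars_sum)
    have "indep_vars (\<lambda>_. borel) (\<lambda>i \<omega>. real (X i \<omega>)) {1..}"
      by (rule indep_vars_compose2[OF indep]) auto
    then show "indep_vars (\<lambda>_. borel) (\<lambda>i \<omega>. real (X i \<omega>)) (insert (Suc n) {1..n})"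
      by (rule indep_vars_subset) auto
  qed auto
  have joint: "\<P>(\<omega> in M. X (Suc n) \<omega> = j \<and> (\<Sum>i = 1..n. X i \<omega>) = l)
     = \<P>(\<omega> in M. X (Suc n) \<omega> = j) * \<P>(\<omega> in M. (\<Sum>i = 1..n. X i \<omega>) = l)" for j l
    using indep_varD[OF iv, of "{real j}" "{real l}"]
    by (simp add: vimage_def Int_def conj_commute conj_assoc flip: of_nat_sum)
  have "{\<omega> \<in> space M. (\<Sum>i = 1..Suc n. X i \<omega>) = m}
     = (\<Union>j\<in>{..m}. {\<omega> \<in> space M. X (Suc n) \<omega> = j \<and> (\<Sum>i = 1..n. X i \<omega>) = m - j})"
    by auto
  then have "\<P>(\<omega> in M. (\<Sum>i = 1..Suc n. X i \<omega>) = m)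
     = (\<Sum>j\<le>m. \<P>(\<omega> in M. X (Suc n) \<omega> = j \<and> (\<Sum>i = 1..n. X i \<omega>) = m - j))"
    by (simp only:) (rule finite_measure_finite_Union, auto simp: disjoint_family_on_def)
  also have "\<dots> = (\<Sum>j\<le>m. if j \<in> {1..k} then uniform_sum_prob k n (m - j) / real k else 0)"
    by (intro sum.cong refl) (unfold joint pX Suc.IH, auto)
  also have "\<dots> = (\<Sum>j \<in> {..m} \<inter> {1..k}. uniform_sum_prob k n (m - j) / real k)"
    by (rule sum.inter_restrict[symmetric]) simp
  also have "{..m} \<inter> {1..k} = {1..min m k}" by auto
  finally show ?case by (simp add: sum_divide_distrib)
qed

text \<open>Independence from the Poisson process is given for the generated sigma-algebras, so the
  events of partial sums have to be placed in that of the jumps.\<close>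

lemma sum_event_in_process_sigma:
  fixes X :: "nat \<Rightarrow> 'a \<Rightarrow> nat"
  shows "{\<omega> \<in> space M. (\<Sum>i = 1..n. X i \<omega>) = m} \<in> process_sigma M {1..} (count_space UNIV) X"
proof -
  define G where "G = (\<Union>i\<in>{1..}. {X i -` A \<inter> space M | A. A \<in> sets (count_space (UNIV :: nat set))})"
  have G: "G \<subseteq> Pow (space M)" by (auto simp: G_def)
  have "X i \<in> measurable (sigma (space M) G) (count_space UNIV)" if "i \<ge> 1" for i
  proof (rule measurableI)
    fix A :: "nat set"
    have "X i -` A \<inter> space M \<in> G" using that by (auto simp: G_def)
    then show "X i -` A \<inter> space (sigma (space M) G) \<in> sets (sigma (space M) G)"
      using G by (auto simp: space_measure_of_conv)
  qed simp
  then have [measurable]: "(\<lambda>\<omega>. \<Sum>i = 1..n. X i \<omega>) \<in> measurable (sigma (space M) G) (count_space UNIV)"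
    by (intro measurable_sum_nat) auto
  have "{\<omega> \<in> space (sigma (space M) G). (\<Sum>i = 1..n. X i \<omega>) = m} \<in> sets (sigma (space M) G)"
    by measurable
  then show ?thesis using G by (simp only: process_sigma_def G_def[symmetric] space_measure_of_conv sets_measure_of)
qed

lemma event_in_process_sigma:
  assumes "i \<in> I" "A \<in> sets S"
  shows "{\<omega> \<in> space M. X i \<omega> \<in> A} \<in> process_sigma M I S X"
proof -
  have "X i -` A \<inter> space M = {\<omega> \<in> space M. X i \<omega> \<in> A}" by auto
  then show ?thesis using assms unfolding process_sigma_def by (intro sigma_sets.Basic) blast
qed

text \<open>Split by the value of \<open>P x\<close>: independence makes each piece a product of a
  jump-sum and a Poisson probability, and the countable sum stops at m.\<close>

lemma prob_ppok:
  assumes "k \<ge> 1" "lam > 0" and data: "ppok_data M k lam P X" and x: "x \<ge> 0"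
  shows "\<P>(\<omega> in M. ppok P X x \<omega> = m) = ppok_pmf k lam m x"
proof -
  have X: "\<And>\<omega>. \<omega>\<in>space M \<Longrightarrow> X 0 \<omega> = 0"
    "prob_space.indep_vars M (\<lambda>_. count_space UNIV) X {1..}"
    "\<And>i. i\<ge>1 \<Longrightarrow> distr M (count_space UNIV) (X i) = measure_pmf (pmf_of_set {1..k})"
    and indep: "indep_processes M {1..} (count_space UNIV) X {0..} (count_space UNIV) P"
    and P: "poisson_process M (real k * lam) P"
    using data by (auto simp: ppok_data_def)
  interpret prob_space M using P by (simp add: poisson_process_def levy_process_def)
  have ind: "indep_set (process_sigma M {1..} (count_space UNIV) X) (process_sigma M {0..} (count_space UNIV) P)"
    using indep by (simp add: indep_processes_def)
  have Pm[measurable]: "P x \<in> measurable M (count_space UNIV)" using P x by (simp add: poisson_process_def)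
  \<comment> \<open>The Poisson law is prescribed for positive times only; at 0 the almost sure
    start at 0 takes over.\<close>
  have pw: "\<P>(\<omega> in M. P x \<omega> = n) = poisson_weight (real k * lam) n x" for n
  proof (cases "x = 0")
    case True
    have "AE \<omega> in M. P 0 \<omega> = 0" using P by (simp add: poisson_process_def levy_process_def)
    then have "\<P>(\<omega> in M. P x \<omega> = n) = \<P>(\<omega> in M. 0 = n)"
      unfolding True by (intro finite_measure_eq_AE) (use Pm True in \<open>auto elim!: eventually_mono\<close>)
    then show ?thesis using True by (cases "n = 0") (simp_all add: poisson_weight_def prob_space)
  next
    case False
    with x have x: "x > 0" by simp
    have "\<P>(\<omega> in M. P x \<omega> = n) = measure (distr M (count_space UNIV) (P x)) {n}"
      by (subst measure_distr) (auto intro!: arg_cong[where f = prob])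
    also have "\<dots> = pmf (poisson_pmf (real k * lam * x)) n"
      using P x by (simp add: poisson_process_def pmf.rep_eq)
    also have "\<dots> = poisson_weight (real k * lam) n x"
      using assms x by (simp add: poisson_weight_def)
    finally show ?thesis .
  qed
  define S where "S n = {\<omega> \<in> space M. (\<Sum>i = 1..n. X i \<omega>) = m}" for n
  define A where "A n = S n \<inter> {\<omega> \<in> space M. P x \<omega> \<in> {n}}" for n
  have S: "S n \<in> process_sigma M {1..} (count_space UNIV) X" for n
    unfolding S_def by (rule sum_event_in_process_sigma)
  have Q: "{\<omega> \<in> space M. P x \<omega> \<in> {n}} \<in> process_sigma M {0..} (count_space UNIV) P" for n
    using x by (intro event_in_process_sigma) auto
  have Aev: "A n \<in> events" for n
    unfolding A_def using S Q indep_setD_ev1[OF ind] indep_setD_ev2[OF ind] by blast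
  have "prob (A n) = uniform_sum_prob k n m * poisson_weight (real k * lam) n x" for n
  proof -
    have "prob (S n) = uniform_sum_prob k n m"
      unfolding S_def by (rule prob_uniform_sum[OF assms(1) X(2,3)])
    then show ?thesis
      using indep_setD[OF ind S Q] pw by (simp add: A_def)
  qed
  then have "(\<lambda>n. poisson_weight (real k * lam) n x * uniform_sum_prob k n m) sums prob (\<Union>n. A n)"
    using finite_measure_UNION[of A] Aev by (auto simp: A_def disjoint_family_on_def mult.commute)
  moreover have "(\<lambda>n. poisson_weight (real k * lam) n x * uniform_sum_prob k n m) sums ppok_pmf k lam m x"
    unfolding ppok_pmf_def by (rule sums_finite) (auto simp: uniform_sum_prob_eq_0)
  moreover have "(\<Union>n. A n) = {\<omega> \<in> space M. ppok P X x \<omega> = m}"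
    by (auto simp: A_def S_def ppok_def X(1) sum.atLeast_Suc_atMost)
  ultimately show ?thesis using sums_unique2 by metis
qed

section \<open>Evaluation at an independent random time\<close>

text \<open>Natural numbers closer than 1 are equal, so a right-continuous counting path is constant
  shortly after x, and \<open>ppok\<close> depends on time only through that path.\<close>

lemma ppok_right_continuous:
  assumes data: "ppok_data M k lam P X" and w: "\<omega> \<in> space M" and x: "x \<ge> 0"
  shows "\<forall>\<^sub>F s in at_right x. ppok P X s \<omega> = ppok P X x \<omega>"
proof -
  have "((\<lambda>s. real (P s \<omega>)) \<longlongrightarrow> real (P x \<omega>)) (at_right x)"
    using data w x by (simp add: ppok_data_def poisson_process_def levy_process_def)
  then have "\<forall>\<^sub>F s in at_right x. dist (real (P s \<omega>)) (real (P x \<omega>)) < 1"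
    by (rule tendstoD) simp
  then show ?thesis
  proof eventually_elim
    case (elim s)
    then have "P s \<omega> = P x \<omega>" by (simp add: dist_real_def)
    then show ?case by (simp add: ppok_def)
  qed
qed

text \<open>The time \<open>E\<close> is approximated from above by times with values in a grid, on which
  the identity follows from independence by summing over the grid points.\<close>

lemma (in prob_space) prob_at_independent_time:
  fixes N :: "real \<Rightarrow> 'a \<Rightarrow> nat" and E :: "'a \<Rightarrow> real"
  assumes E[measurable]: "E \<in> borel_measurable M" and nn: "\<And>\<omega>. \<omega> \<in> space M \<Longrightarrow> 0 \<le> E \<omega>"
    and N: "\<And>x. x \<ge> 0 \<Longrightarrow> {\<omega> \<in> space M. N x \<omega> = m} \<in> events"
    and indep: "\<And>x A. x \<ge> 0 \<Longrightarrow> A \<in> sets borel \<Longrightarrow>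
      prob ({\<omega> \<in> space M. E \<omega> \<in> A} \<inter> {\<omega> \<in> space M. N x \<omega> = m})
        = \<P>(\<omega> in M. E \<omega> \<in> A) * \<P>(\<omega> in M. N x \<omega> = m)"
    and right: "\<And>\<omega> x. \<omega> \<in> space M \<Longrightarrow> x \<ge> 0 \<Longrightarrow> \<forall>\<^sub>F s in at_right x. N s \<omega> = N x \<omega>"
    and p: "\<And>x. x \<ge> 0 \<Longrightarrow> \<P>(\<omega> in M. N x \<omega> = m) = p x" "continuous_on UNIV p"
  shows "\<P>(\<omega> in M. N (E \<omega>) \<omega> = m) = expectation (\<lambda>\<omega>. p (E \<omega>))"
proof -
  have pm[measurable]: "p \<in> borel_measurable borel"
    using p(2) by (rule borel_measurable_continuous_onI)
  have p1: "\<bar>p x\<bar> \<le> 1" if "x \<ge> 0" for x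
    using p(1)[OF that] by (metis abs_of_nonneg measure_nonneg prob_le_1)
  \<comment> \<open>The \<open>+ 1\<close> puts the grid point \<open>D n\<close> strictly above
    \<open>E\<close>, so that \<open>D n\<close> tends to \<open>E\<close> from the right, where the
    paths of \<open>N\<close> are eventually constant.\<close>
  define r where "r n i = (real i + 1) / real (Suc n)" for n i :: nat
  define ix where "ix n \<omega> = nat \<lfloor>E \<omega> * real (Suc n)\<rfloor>" for n \<omega>
  define D where "D n \<omega> = r n (ix n \<omega>)" for n \<omega>
  have r0: "r n i \<ge> 0" for n i by (simp add: r_def)
  have ixm[measurable]: "ix n \<in> measurable M (count_space UNIV)" for n
    unfolding ix_def by measurable
  have Dm[measurable]: "D n \<in> borel_measurable M" for n
    unfolding D_def r_def by measurable
  have D: "E \<omega> < D n \<omega>" "D n \<omega> \<le> E \<omega> + inverse (real (Suc n))" if "\<omega> \<in> space M" for n \<omega>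
  proof -
    have "real (ix n \<omega>) = of_int \<lfloor>E \<omega> * real (Suc n)\<rfloor>"
      using nn[OF that] by (simp add: ix_def)
    then have "real (ix n \<omega>) \<le> E \<omega> * real (Suc n)" "E \<omega> * real (Suc n) < real (ix n \<omega>) + 1"
      by linarith+
    then show "E \<omega> < D n \<omega>" "D n \<omega> \<le> E \<omega> + inverse (real (Suc n))"
      unfolding D_def r_def by (simp_all add: field_simps del: of_nat_Suc)
  qed
  have Dlim: "filterlim (\<lambda>n. D n \<omega>) (at_right (E \<omega>)) sequentially" if w: "\<omega> \<in> space M" for \<omega>
  proof -
    have "\<forall>n. D n \<omega> \<in> {E \<omega><..} \<and> D n \<omega> \<noteq> E \<omega>"
      using D(1)[OF w] by (metis greaterThan_iff less_irrefl)
    moreover have "(\<lambda>n. D n \<omega>) \<longlonglongrightarrow> E \<omega>"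
    proof (rule tendsto_sandwich[OF _ _ tendsto_const LIMSEQ_inverse_real_of_nat_add])
      show "\<forall>\<^sub>F n in sequentially. E \<omega> \<le> D n \<omega>"
        by (intro always_eventually allI less_imp_le D(1)[OF w])
      show "\<forall>\<^sub>F n in sequentially. D n \<omega> \<le> E \<omega> + inverse (real (Suc n))"
        by (intro always_eventually allI D(2)[OF w])
    qed
    ultimately show ?thesis unfolding filterlim_at by simp
  qed
  define S where "S n i = {\<omega> \<in> space M. ix n \<omega> = i}" for n i
  define A where "A n i = S n i \<inter> {\<omega> \<in> space M. N (r n i) \<omega> = m}" for n i
  have Sev: "S n i \<in> events" for n i unfolding S_def by measurable
  have Aev: "A n i \<in> events" for n i unfolding A_def using Sev N[OF r0] by blast
  have US: "(\<Union>i. S n i) = space M" for n by (auto simp: S_def)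
  have UA: "(\<Union>i. A n i) = {\<omega> \<in> space M. N (D n \<omega>) \<omega> = m}" for n
    by (auto simp: A_def S_def D_def)
  have probA: "prob (A n i) = p (r n i) * prob (S n i)" for n i
  proof -
    have "{x. nat \<lfloor>x * real (Suc n)\<rfloor> = i} \<in> sets (borel :: real measure)" by measurable
    from indep[OF r0 this, of n i] show ?thesis
      by (simp add: A_def S_def ix_def p(1)[OF r0] mult.commute)
  qed
  have step: "prob {\<omega> \<in> space M. N (D n \<omega>) \<omega> = m} = expectation (\<lambda>\<omega>. p (D n \<omega>))" for n
  proof -
    have D0: "D n \<omega> \<ge> 0" for \<omega> unfolding D_def by (rule r0)
    have int: "integrable M (\<lambda>\<omega>. p (D n \<omega>))"
      by (rule integrable_const_bound[where B = 1]) (use p1 D0 in auto)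
    have "(LINT \<omega>:(\<Union>i. S n i)|M. p (D n \<omega>)) = (\<Sum>i. LINT \<omega>:S n i|M. p (D n \<omega>))"
    proof (rule lebesgue_integral_countable_add)
      show "set_integrable M (\<Union>i. S n i) (\<lambda>\<omega>. p (D n \<omega>))"
        unfolding US set_integrable_def
        by (subst Bochner_Integration.integrable_cong[OF refl, where g = "\<lambda>\<omega>. p (D n \<omega>)"]) (auto simp: int)
    qed (use Sev in \<open>auto simp: S_def\<close>)
    moreover have "(LINT \<omega>:(\<Union>i. S n i)|M. p (D n \<omega>)) = expectation (\<lambda>\<omega>. p (D n \<omega>))"
      unfolding US set_lebesgue_integral_def by (intro Bochner_Integration.integral_cong) auto
    moreover have "(LINT \<omega>:S n i|M. p (D n \<omega>)) = prob (A n i)" for i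
    proof -
      have "(LINT \<omega>:S n i|M. p (D n \<omega>)) = (\<integral>\<omega>. p (r n i) * indicator (S n i) \<omega> \<partial>M)"
        unfolding set_lebesgue_integral_def
        by (intro Bochner_Integration.integral_cong) (auto simp: S_def D_def indicator_def)
      then show ?thesis using probA Sev by simp
    qed
    moreover have "(\<lambda>i. prob (A n i)) sums prob (\<Union>i. A n i)"
      by (rule finite_measure_UNION) (use Aev in \<open>auto simp: A_def S_def disjoint_family_on_def\<close>)
    ultimately show ?thesis using UA by (simp add: sums_iff)
  qed
  let ?I = "\<lambda>Y \<omega>. indicator {\<omega> \<in> space M. N (Y \<omega>) \<omega> = m} \<omega> :: real"
  have Im[measurable]: "?I (D n) \<in> borel_measurable M" for n
    unfolding UA[symmetric] using Aev by measurable
  have Ilim: "(\<lambda>n. ?I (D n) \<omega>) \<longlonglongrightarrow> ?I E \<omega>" if w: "\<omega> \<in> space M" for \<omega>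
  proof -
    have "\<forall>\<^sub>F n in sequentially. N (D n \<omega>) \<omega> = N (E \<omega>) \<omega>"
      using right[OF w nn[OF w]] Dlim[OF w] by (rule eventually_compose_filterlim)
    then show ?thesis
      by (intro tendsto_eventually) (auto elim!: eventually_mono simp: indicator_def)
  qed
  have IE[measurable]: "?I E \<in> borel_measurable M"
    by (rule borel_measurable_LIMSEQ_real[OF Ilim Im])
  have ev: "{\<omega> \<in> space M. N (E \<omega>) \<omega> = m} \<in> events"
  proof -
    have "{\<omega> \<in> space M. N (E \<omega>) \<omega> = m} = {\<omega> \<in> space M. ?I E \<omega> = 1}" by (auto simp: indicator_def)
    also have "\<dots> \<in> events" by measurable
    finally show ?thesis .
  qed
  have "(\<lambda>n. \<integral>\<omega>. ?I (D n) \<omega> \<partial>M) \<longlonglongrightarrow> (\<integral>\<omega>. ?I E \<omega> \<partial>M)"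
    by (rule integral_dominated_convergence[where w = "\<lambda>_. 1"]) (auto intro!: AE_I2 Ilim)
  moreover have "(\<integral>\<omega>. ?I (D n) \<omega> \<partial>M) = expectation (\<lambda>\<omega>. p (D n \<omega>))" for n
  proof -
    have "{\<omega> \<in> space M. N (D n \<omega>) \<omega> = m} \<in> events" unfolding UA[symmetric] using Aev by auto
    then show ?thesis using step[of n] by simp
  qed
  moreover have "(\<integral>\<omega>. ?I E \<omega> \<partial>M) = \<P>(\<omega> in M. N (E \<omega>) \<omega> = m)" using ev by simp
  moreover have "(\<lambda>n. expectation (\<lambda>\<omega>. p (D n \<omega>))) \<longlonglongrightarrow> expectation (\<lambda>\<omega>. p (E \<omega>))"
  proof (rule integral_dominated_convergence[where w = "\<lambda>_. 1"])
    show "AE \<omega> in M. (\<lambda>n. p (D n \<omega>)) \<longlonglongrightarrow> p (E \<omega>)"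
    proof (rule AE_I2)
      fix \<omega> assume w: "\<omega> \<in> space M"
      have "(\<lambda>n. D n \<omega>) \<longlonglongrightarrow> E \<omega>" using Dlim[OF w] by (simp add: filterlim_at)
      then show "(\<lambda>n. p (D n \<omega>)) \<longlonglongrightarrow> p (E \<omega>)"
        by (rule isCont_tendsto_compose[rotated]) (use p(2) in \<open>simp add: continuous_on_eq_continuous_at\<close>)
    qed
    show "AE \<omega> in M. norm (p (D n \<omega>)) \<le> 1" for n
      by (rule AE_I2) (use p1 r0 in \<open>simp add: D_def\<close>)
  qed auto
  ultimately show ?thesis using LIMSEQ_unique by simp
qed

section \<open>Time derivatives of expectations at the exit time\<close>

text \<open>The Fubini identity in terms of the gauge integral, for which continuity and
  differentiability of primitives are at hand. The cutoff in \<open>K\<close> allows closed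
  intervals starting at 0.\<close>

lemma ig_tail_integral_eq:
  assumes par: "\<delta> > 0" "\<gamma> > 0"
    and q: "q \<in> borel_measurable borel" "\<And>x. 0 < x \<Longrightarrow> \<bar>q x\<bar> \<le> B"
  defines "K \<equiv> \<lambda>u. indicator {0<..} u * (LINT x:{0<..}|lborel. q x * ig_density \<delta> \<gamma> x u)"
  shows "K integrable_on {0..T}"
    and "t > 0 \<Longrightarrow> (LINT x:{0<..}|lborel. q x * ig_cdf \<delta> \<gamma> x t) = integral {0..t} K"
proof -
  have *: "set_integrable lborel {0..t} K"
    "(LINT x:{0<..}|lborel. q x * ig_cdf \<delta> \<gamma> x t) = (LINT u:{0..t}|lborel. K u)" if "t > 0" for t
  proof -
    have "(\<lambda>u. indicator {0..t} u *\<^sub>R K u)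
        = (\<lambda>u. indicator {0<..t} u *\<^sub>R (LINT x:{0<..}|lborel. q x * ig_density \<delta> \<gamma> x u))"
      by (auto simp: K_def indicator_def fun_eq_iff)
    then show "set_integrable lborel {0..t} K"
      "(LINT x:{0<..}|lborel. q x * ig_cdf \<delta> \<gamma> x t) = (LINT u:{0..t}|lborel. K u)"
      using ig_space_time_Fubini[OF par that q]
      by (simp_all add: set_integrable_def set_lebesgue_integral_def)
  qed
  show "t > 0 \<Longrightarrow> (LINT x:{0<..}|lborel. q x * ig_cdf \<delta> \<gamma> x t) = integral {0..t} K"
    using * set_borel_integral_eq_integral(2) by metis
  show "K integrable_on {0..T}"
  proof (cases "T > 0")
    case True
    then show ?thesis using *(1) set_borel_integral_eq_integral(1) by blast
  next
    case False
    then have "T = 0 \<or> T < 0" by linarith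
    then show ?thesis using integrable_on_refl[of K 0] by auto
  qed
qed

text \<open>Primitives are continuous, and a primitive based at 0 tends to 0 there; measurability
  and boundedness of \<open>q\<close> are enough for this.\<close>

lemma ig_tail_integral_continuous:
  assumes par: "\<delta> > 0" "\<gamma> > 0"
    and q: "q \<in> borel_measurable borel" "\<And>x. 0 < x \<Longrightarrow> \<bar>q x\<bar> \<le> B"
  shows "t > 0 \<Longrightarrow> isCont (\<lambda>t. LINT x:{0<..}|lborel. q x * ig_cdf \<delta> \<gamma> x t) t"
    and "((\<lambda>t. LINT x:{0<..}|lborel. q x * ig_cdf \<delta> \<gamma> x t) \<longlongrightarrow> 0) (at_right 0)"
proof -
  define K where "K = (\<lambda>u. indicator {0<..} u * (LINT x:{0<..}|lborel. q x * ig_density \<delta> \<gamma> x u))"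
  let ?S = "\<lambda>t. LINT x:{0<..}|lborel. q x * ig_cdf \<delta> \<gamma> x t"
  note eq = ig_tail_integral_eq[OF assms, folded K_def]
  have c: "continuous_on {0..T} (\<lambda>t. integral {0..t} K)" for T
    by (rule indefinite_integral_continuous_1[OF eq(1)])
  show "isCont ?S t" if t: "t > 0"
  proof -
    have "isCont (\<lambda>t. integral {0..t} K) t"
      by (rule continuous_on_interior[OF c[of "t + 1"]]) (use t in auto)
    moreover have "\<forall>\<^sub>F s in nhds t. ?S s = integral {0..s} K"
      using eventually_nhds_in_open[of "{0<..}" t] t by (auto elim!: eventually_mono intro: eq(2))
    ultimately show ?thesis by (rule isCont_cong[THEN iffD2, rotated])
  qed
  have "((\<lambda>t. integral {0..t} K) \<longlongrightarrow> integral {0..0} K) (at 0 within {0..1})"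
    using c[of 1, unfolded continuous_on_def, THEN bspec, of 0] by simp
  then have "((\<lambda>t. integral {0..t} K) \<longlongrightarrow> 0) (at_right 0)"
    by (simp add: at_within_Icc_at_right)
  then show "(?S \<longlongrightarrow> 0) (at_right 0)"
    by (rule Lim_transform_eventually)
       (use eventually_at_right_less[of "0::real"] in \<open>auto elim!: eventually_mono simp: eq(2)\<close>)
qed

lemma ig_tail_integral_has_derivative:
  assumes par: "\<delta> > 0" "\<gamma> > 0"
    and q: "q \<in> borel_measurable borel" "\<And>x. 0 < x \<Longrightarrow> \<bar>q x\<bar> \<le> B"
    and cont: "\<And>u. u > 0 \<Longrightarrow> isCont (\<lambda>u. LINT x:{0<..}|lborel. q x * ig_density \<delta> \<gamma> x u) u"
    and t: "t > 0"
  shows "((\<lambda>t. LINT x:{0<..}|lborel. q x * ig_cdf \<delta> \<gamma> x t) has_real_derivative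
    (LINT x:{0<..}|lborel. q x * ig_density \<delta> \<gamma> x t)) (at t)"
proof -
  let ?k = "\<lambda>u. LINT x:{0<..}|lborel. q x * ig_density \<delta> \<gamma> x u"
  define K where "K = (\<lambda>u. indicator {0<..} u * ?k u)"
  let ?S = "\<lambda>t. LINT x:{0<..}|lborel. q x * ig_cdf \<delta> \<gamma> x t"
  note eq = ig_tail_integral_eq[OF par q, folded K_def]
  have Kk: "K u = ?k u" if "u > 0" for u using that by (simp add: K_def)
  have "continuous_on {t/2..t+1} ?k"
    by (rule continuous_at_imp_continuous_on) (use t cont in auto)
  then have "continuous_on {t/2..t+1} K"
    by (rule continuous_on_eq) (use t Kk in auto)
  \<comment> \<open>The base point t/2 stays away from 0, where \<open>K\<close> is cut off and may
    fail to be continuous.\<close>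
  then have "((\<lambda>s. integral {t/2..s} K) has_real_derivative K t) (at t within {t/2..t+1})"
    by (rule integral_has_real_derivative) (use t in auto)
  then have "((\<lambda>s. integral {t/2..s} K) has_real_derivative K t) (at t)"
    using t by (subst (asm) at_within_interior) auto
  then have d: "((\<lambda>s. integral {0..t/2} K + integral {t/2..s} K) has_real_derivative K t) (at t)"
    by (auto intro!: derivative_eq_intros)
  have e: "\<forall>\<^sub>F s in nhds t. integral {0..t/2} K + integral {t/2..s} K = ?S s"
    using eventually_nhds_in_open[of "{t/2<..}" t] t
    by (auto elim!: eventually_mono simp: eq(2) intro!: Henstock_Kurzweil_Integration.integral_combine eq(1))
  show ?thesis
    using DERIV_cong_ev[OF refl e refl, THEN iffD1, OF d] by (simp only: Kk[OF t])
qed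

lemma isCont_ig_exit_density_time:
  assumes "t > 0"
  shows "isCont (\<lambda>t. ig_exit_density \<delta> \<gamma> x t) t"
proof -
  have "isCont (\<lambda>t. ig_arg \<delta> g x t) t" for g
    using DERIV_isCont[OF ig_arg_has_derivative_time[OF assms]] .
  then show ?thesis unfolding ig_exit_density_def using assms
    by (intro continuous_intros isCont_o2[OF _ isCont_std_normal_density]
          isCont_o2[OF _ isCont_std_normal_cdf]) auto
qed

text \<open>The integration-by-parts formula rewrites the integral through integrals against
  \<open>ig_cdf\<close>, already known to be continuous, and elementary functions of time. This is
  what makes \<open>ig_tail_integral_has_derivative\<close> applicable.\<close>

lemma ig_density_integral_continuous:
  assumes par: "\<delta> > 0" "\<gamma> > 0" "t > 0"
    and q: "\<And>x. (q has_real_derivative q1 x) (at x)" "\<And>x. (q1 has_real_derivative q2 x) (at x)"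
      "\<And>x. isCont q2 x"
    and B: "\<And>x. 0 < x \<Longrightarrow> \<bar>q x\<bar> \<le> B" "\<And>x. 0 < x \<Longrightarrow> \<bar>q1 x\<bar> \<le> B" "\<And>x. 0 < x \<Longrightarrow> \<bar>q2 x\<bar> \<le> B"
  shows "isCont (\<lambda>u. LINT x:{0<..}|lborel. q x * ig_density \<delta> \<gamma> x u) t"
proof -
  have c: "isCont q1 x" for x using q DERIV_isCont by blast
  have m: "q1 \<in> borel_measurable borel" "q2 \<in> borel_measurable borel"
    using c q(3) by (auto intro!: borel_measurable_continuous_onI continuous_at_imp_continuous_on)
  let ?r = "\<lambda>u. ((LINT x:{0<..}|lborel. q2 x * ig_cdf \<delta> \<gamma> x u)
      + 2 * \<delta> * \<gamma> * (LINT x:{0<..}|lborel. q1 x * ig_cdf \<delta> \<gamma> x u)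
      + ig_exit_density \<delta> \<gamma> 0 u * q 0 + 2 * \<delta> * \<gamma> * q 0 + q1 0) / (2 * \<delta>\<^sup>2)"
  have "isCont ?r t"
    by (intro continuous_intros isCont_ig_exit_density_time
          ig_tail_integral_continuous(1)[OF par(1,2) m(1) B(2)]
          ig_tail_integral_continuous(1)[OF par(1,2) m(2) B(3)] par) (use par in auto)
  moreover have "\<forall>\<^sub>F u in nhds t. ?r u = (LINT x:{0<..}|lborel. q x * ig_density \<delta> \<gamma> x u)"
    using eventually_nhds_in_open[of "{0<..}" t] par
    by (auto elim!: eventually_mono simp: ig_density_space_integral[OF par(1,2) _ q B, symmetric])
  ultimately show ?thesis by (rule isCont_cong[THEN iffD1, rotated])
qed

section \<open>Distributional derivatives and densities on the half-line\<close>

lemma test_functionD: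
  assumes "test_function_on U \<phi>"
  shows "\<And>x. (\<phi> has_real_derivative deriv \<phi> x) (at x)" "\<And>x. isCont (deriv \<phi>) x"
    and "\<exists>T>0. \<forall>t>T. \<phi> t = 0 \<and> deriv \<phi> t = 0" "0 \<notin> U \<Longrightarrow> \<phi> 0 = 0"
proof -
  have d: "(deriv ^^ n) \<phi> field_differentiable at x" for n x
    using assms by (simp add: test_function_on_def)
  obtain C where C: "compact C" "C \<subseteq> U" "\<And>x. x \<notin> C \<Longrightarrow> \<phi> x = 0"
    using assms by (auto simp: test_function_on_def)
  show "(\<phi> has_real_derivative deriv \<phi> x) (at x)" for x
    using d[of 0 x] by (simp add: DERIV_deriv_iff_field_differentiable)
  show "isCont (deriv \<phi>) x" for x
    using d[of 1 x] by (simp add: field_differentiable_imp_continuous_at)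
  show "0 \<notin> U \<Longrightarrow> \<phi> 0 = 0" using C by blast
  obtain T where T: "T > 0" "\<And>x. x \<in> C \<Longrightarrow> norm x \<le> T"
    using compact_imp_bounded[OF C(1)] by (auto simp: bounded_pos)
  have z: "\<phi> t = 0" if "t > T" for t using that T C(3)[of t] by fastforce
  have "deriv \<phi> t = 0" if t: "t > T" for t
  proof -
    have "\<forall>\<^sub>F s in nhds t. \<phi> s = 0"
      using eventually_nhds_in_open[of "{T<..}" t] t by (auto elim!: eventually_mono intro: z)
    then have "deriv \<phi> t = deriv (\<lambda>_. 0) t" by (intro deriv_cong_ev) auto
    then show ?thesis by simp
  qed
  then show "\<exists>T>0. \<forall>t>T. \<phi> t = 0 \<and> deriv \<phi> t = 0" using T z by blast
qed

text \<open>Integrate the derivative of u \<phi> over positive times: nothing remains at infinity,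
  and the boundary value u0 \<phi>(0) records the jump made by extending u by zero.\<close>

lemma dist_deriv_causal:
  assumes der: "\<And>t. t > 0 \<Longrightarrow> (u has_real_derivative R t) (at t)"
    and cont: "\<And>t. t > 0 \<Longrightarrow> isCont R t"
    and int: "\<And>T. T > 0 \<Longrightarrow> set_integrable lborel {0<..T} R"
    and bdd: "\<And>t. t > 0 \<Longrightarrow> \<bar>u t\<bar> \<le> B"
    and lim: "(u \<longlongrightarrow> u0) (at_right 0)"
    and \<phi>: "test_function_on U \<phi>"
  shows "dist_deriv (causal_dist u) \<phi> = causal_dist R \<phi> + dirac_delta \<phi> * u0"
proof -
  note d\<phi> = test_functionD(1,2)[OF \<phi>]
  obtain T where T: "T > 0" "\<And>t. t > T \<Longrightarrow> \<phi> t = 0 \<and> deriv \<phi> t = 0"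
    using test_functionD(3)[OF \<phi>] by blast
  have c\<phi>: "isCont \<phi> t" for t using d\<phi>(1) DERIV_isCont by blast
  have [measurable]: "\<phi> \<in> borel_measurable borel" "deriv \<phi> \<in> borel_measurable borel"
    using c\<phi> d\<phi>(2) by (auto intro!: borel_measurable_continuous_onI continuous_at_imp_continuous_on)
  have bounded: "\<exists>C. \<forall>t\<in>{0<..T}. \<bar>f t\<bar> \<le> C" if "\<And>t. isCont f t" for f :: "real \<Rightarrow> real"
  proof -
    have "compact (f ` {0..T})"
      using that by (intro compact_continuous_image continuous_at_imp_continuous_on) auto
    then obtain C where "\<forall>y\<in>f ` {0..T}. norm y \<le> C"
      using compact_imp_bounded bounded_iff by metis
    then show ?thesis by (intro exI[of _ C]) auto
  qed
  \<comment> \<open>\<open>R\<close> is integrable only up to finite times; as \<phi> and its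
    derivative vanish beyond \<open>T\<close>, this is enough for the products.\<close>
  have ext: "set_integrable lborel {0<..} f" if "set_integrable lborel {0<..T} f" "\<And>t. t > T \<Longrightarrow> f t = 0"
    for f :: "real \<Rightarrow> real"
  proof -
    have "(\<lambda>t. indicator {0<..} t *\<^sub>R f t) = (\<lambda>t. indicator {0<..T} t *\<^sub>R f t)"
      using that(2) by (auto simp: indicator_def not_le fun_eq_iff)
    then show ?thesis using that(1) by (simp add: set_integrable_def)
  qed
  have i1: "set_integrable lborel {0<..} (\<lambda>t. R t * \<phi> t)"
  proof -
    obtain C where "\<And>t. t \<in> {0<..T} \<Longrightarrow> \<bar>\<phi> t\<bar> \<le> C" using bounded[OF c\<phi>] by blast
    then have "set_integrable lborel {0<..T} (\<lambda>t. \<phi> t * R t)"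
      by (intro set_integrable_mult_bounded int T) auto
    then show ?thesis by (intro ext) (use T in \<open>auto simp: mult.commute\<close>)
  qed
  have i2: "set_integrable lborel {0<..} (\<lambda>t. u t * deriv \<phi> t)"
  proof -
    obtain C where C: "\<And>t. t \<in> {0<..T} \<Longrightarrow> \<bar>deriv \<phi> t\<bar> \<le> C" using bounded[OF d\<phi>(2)] by blast
    have "continuous_on {0<..T} u"
      by (intro continuous_at_imp_continuous_on ballI DERIV_isCont[OF der]) simp
    then have um: "set_borel_measurable lborel {0<..T} u"
      unfolding set_borel_measurable_def using borel_measurable_continuous_on_indicator[of "{0<..T}" u] by simp
    have "set_integrable lborel {0<..T} (\<lambda>_. B)"
      unfolding set_integrable_def using T(1) by (intro integrable_scaleR_left integrable_real_indicator) simp_all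
    then have "set_integrable lborel {0<..T} u"
      by (rule set_integrable_bound[OF _ um]) (use bdd in \<open>auto intro!: AE_I2 intro: order_trans[OF _ abs_ge_self]\<close>)
    then have "set_integrable lborel {0<..T} (\<lambda>t. deriv \<phi> t * u t)"
      by (rule set_integrable_mult_bounded[where B = C]) (use C in auto)
    then show ?thesis by (intro ext) (use T in \<open>auto simp: mult.commute\<close>)
  qed
  have "(LINT t:{0<..}|lborel. R t * \<phi> t + u t * deriv \<phi> t) = 0 - u0 * \<phi> 0"
  proof (rule FTC_Ioi[where F = "\<lambda>t. u t * \<phi> t"])
    show "((\<lambda>t. u t * \<phi> t) has_real_derivative R t * \<phi> t + u t * deriv \<phi> t) (at t)" if "0 < t" for t
      by (rule DERIV_cong[OF DERIV_mult[OF der[OF that] d\<phi>(1)]]) (simp add: mult.commute)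
    show "isCont (\<lambda>t. R t * \<phi> t + u t * deriv \<phi> t) t" if "0 < t" for t
      using DERIV_isCont[OF der[OF that]] by (intro continuous_intros cont c\<phi> d\<phi> that)
    show "((\<lambda>t. u t * \<phi> t) \<longlongrightarrow> u0 * \<phi> 0) (at_right 0)"
      using c\<phi>[of 0] by (intro tendsto_mult lim) (simp add: isCont_def filterlim_at_split)
    show "((\<lambda>t. u t * \<phi> t) \<longlongrightarrow> 0) at_top"
      by (rule tendsto_eventually, rule eventually_mono[OF eventually_gt_at_top[of T]]) (use T(2) in auto)
  qed (intro set_integral_add i1 i2)
  then show ?thesis
    by (simp add: dist_deriv_def causal_dist_def dirac_delta_def set_integral_add(2)[OF i1 i2] mult.commute)
qed

text \<open>The density is only known almost everywhere, but its limit at \<open>0\<close> is the derivative of the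
  distribution function there.\<close>

lemma density_limit_at_0:
  fixes f F :: "real \<Rightarrow> real"
  assumes int: "set_integrable lborel {0<..} f"
    and F: "\<And>x. x > 0 \<Longrightarrow> (LINT y:{0<..<x}|lborel. f y) = F x - F 0"
    and lim: "(f \<longlongrightarrow> c) (at_right 0)" and D: "(F has_real_derivative d) (at 0)"
  shows "c = d"
proof -
  have "((\<lambda>x. (F x - F 0) / x) \<longlongrightarrow> d) (at_right 0)"
    using D by (simp add: DERIV_def filterlim_at_split)
  moreover have "((\<lambda>x. (F x - F 0) / x) \<longlongrightarrow> c) (at_right 0)"
  proof (rule tendstoI)
    fix e :: real assume e: "e > 0"
    then have "\<forall>\<^sub>F y in at_right 0. dist (f y) c < e / 2" using lim by (intro tendstoD) auto
    then obtain b where b: "b > 0" "\<And>y. 0 < y \<Longrightarrow> y < b \<Longrightarrow> dist (f y) c < e / 2"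
      unfolding eventually_at_right_field by blast
    have b': "c - e / 2 \<le> f y" "f y \<le> c + e / 2" if "0 < y" "y < b" for y
      using b(2)[OF that] unfolding dist_real_def by linarith+
    have "dist ((F x - F 0) / x) c < e" if x: "0 < x" "x < b" for x
    proof -
      have i: "set_integrable lborel {0<..<x} f" by (rule set_integrable_subset[OF int]) auto
      have ic: "set_integrable lborel {0<..<x} (\<lambda>_. a)" for a :: real
        unfolding set_integrable_def using x by (intro integrable_scaleR_left integrable_real_indicator) simp_all
      have v: "(LINT y:{0<..<x}|lborel. a) = a * x" for a :: real
        using x by (simp add: set_lebesgue_integral_def)
      have "(LINT y:{0<..<x}|lborel. c - e / 2) \<le> (LINT y:{0<..<x}|lborel. f y)"
        by (rule set_integral_mono[OF ic i]) (use b' x in auto)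
      moreover have "(LINT y:{0<..<x}|lborel. f y) \<le> (LINT y:{0<..<x}|lborel. c + e / 2)"
        by (rule set_integral_mono[OF i ic]) (use b' x in auto)
      ultimately have "c - e / 2 \<le> (F x - F 0) / x" "(F x - F 0) / x \<le> c + e / 2"
        using x unfolding v F[OF x(1)] by (simp_all add: field_simps)
      then show ?thesis using e by (simp add: dist_real_def abs_real_def)
    qed
    then show "\<forall>\<^sub>F x in at_right 0. dist ((F x - F 0) / x) c < e"
      using b(1) unfolding eventually_at_right_field by blast
  qed
  ultimately show ?thesis using tendsto_unique trivial_limit_at_right_real by blast
qed

text \<open>The point 0 is null, so closed and open half-lines give the same integrals; likewise a
  law with a density has no atoms, which settles the boundary case of the exit-time tail.\<close>

lemma (in prob_space) distributed_half_line:
  fixes f Q :: "real \<Rightarrow> real"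
  assumes D: "distributed M lborel Y (\<lambda>x. ennreal (f x * indicator {0..} x))"
    and nn: "\<And>x. 0 \<le> x \<Longrightarrow> 0 \<le> f x"
  shows "set_integrable lborel {0<..} f"
    and "Q \<in> borel_measurable borel \<Longrightarrow> expectation (\<lambda>\<omega>. Q (Y \<omega>)) = (LINT x:{0<..}|lborel. Q x * f x)"
    and "AE \<omega> in M. Y \<omega> \<noteq> a"
proof -
  define g where "g x = f x * indicator {0..} x" for x :: real
  have g0: "0 \<le> g x" for x using nn by (simp add: g_def indicator_def)
  have D: "distributed M lborel Y (\<lambda>x. ennreal (g x))" using D by (simp add: g_def)
  have gm[measurable]: "g \<in> borel_measurable lborel"
    using distributed_real_measurable[OF _ D] g0 by auto
  have gf: "(\<lambda>x. indicator {0<..} x * (Q x * g x)) = (\<lambda>x. indicator {0<..} x *\<^sub>R (Q x * f x))" for Q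
    by (auto simp: g_def indicator_def fun_eq_iff)
  have ae: "AE x in lborel. g x * Q x = indicator {0<..} x * (Q x * g x)" for Q :: "real \<Rightarrow> real"
    using AE_lborel_singleton[of "0::real"]
    by eventually_elim (auto simp: g_def indicator_def)
  have "integrable lborel (\<lambda>x. g x * 1)"
    by (subst distributed_integrable[OF D]) (use g0 in auto)
  then have "integrable lborel (\<lambda>x. indicator {0<..} x * (1 * g x))"
    by (rule integrable_cong_AE_imp) (use ae[of "\<lambda>_. 1"] in auto)
  then show "set_integrable lborel {0<..} f"
    unfolding gf[of "\<lambda>_. 1"] by (simp add: set_integrable_def)
  show "expectation (\<lambda>\<omega>. Q (Y \<omega>)) = (LINT x:{0<..}|lborel. Q x * f x)"
    if Q[measurable]: "Q \<in> borel_measurable borel"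
  proof -
    have "expectation (\<lambda>\<omega>. Q (Y \<omega>)) = (\<integral>x. g x * Q x \<partial>lborel)"
      by (rule distributed_integral[OF D, symmetric]) (use g0 in auto)
    also have "\<dots> = (\<integral>x. indicator {0<..} x * (Q x * g x) \<partial>lborel)"
      by (rule integral_cong_AE[OF _ _ ae]) measurable
    finally show ?thesis unfolding gf by (simp add: set_lebesgue_integral_def)
  qed
  have Ym: "Y \<in> measurable M lborel" using D by (simp add: distributed_def)
  have "AE x in distr M lborel Y. x \<noteq> a"
    unfolding distributed_distr_eq_density[OF D]
    by (subst AE_density) (use AE_lborel_singleton[of a] in auto)
  then show "AE \<omega> in M. Y \<omega> \<noteq> a"
    by (subst (asm) AE_distr_iff[OF Ym]) auto
qed

section \<open>The difference-differential equation for the time-changed process\<close>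

theorem theorem5p2:
  fixes M :: "'a measure"
    and k :: nat
    and lam \<delta> \<gamma> :: real
    and P N :: "real \<Rightarrow> 'a \<Rightarrow> nat"
    and X :: "nat \<Rightarrow> 'a \<Rightarrow> nat"
    and G E :: "real \<Rightarrow> 'a \<Rightarrow> real"
    and h :: "real \<Rightarrow> real \<Rightarrow> real"
    and p phat :: "nat \<Rightarrow> real \<Rightarrow> real"
    and dp0 :: "nat \<Rightarrow> real"
  assumes "k \<ge> 1" and "lam > 0" and "\<delta> > 0" and "\<gamma> > 0"
    and "prob_space M"
    and "ppok_data M k lam P X"
    and "N = ppok P X"
    and "p = (\<lambda>m x. measure M {\<omega> \<in> space M. N x \<omega> = m})"
    and "inverse_gaussian_subordinator M \<delta> \<gamma> G"
    and "E = first_exit_time G"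
    and "indep_processes M {0..} borel E {0..} (count_space UNIV) N"
    and "\<And>t x. t > 0 \<Longrightarrow> x \<ge> 0 \<Longrightarrow> h x t \<ge> 0"
    and "\<And>t. t > 0 \<Longrightarrow> distributed M lborel (E t) (\<lambda>x. ennreal (h x t * indicator {0..} x))"
    and "\<And>t. t > 0 \<Longrightarrow> ((\<lambda>x. h x t) \<longlongrightarrow> h 0 t) (at_right 0)"
    and "phat = (\<lambda>m t. measure M {\<omega> \<in> space M. N (E t \<omega>) \<omega> = m})"
    and "dp0 = (\<lambda>m. if m = 0 then - real k * lam else if m \<le> k then lam else 0)"
  shows
    "(\<forall>m. (p m has_real_derivative dp0 m) (at 0 within {0..})) \<and>
     (\<forall>m\<ge>1.
        let R = (\<lambda>t. 1 / (2 * \<delta>\<^sup>2) *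
          ((LINT x:{0<..}|lborel.
              ((real k * lam)\<^sup>2 * p m x
               - 2 * real k * lam\<^sup>2 * (\<Sum>j = 1..min m k. p (m - j) x)
               + lam\<^sup>2 * (\<Sum>j = 1..min m k. \<Sum>i = 1..min (m - j) k. p (m - j - i) x)) * h x t)
           + 2 * \<delta> * \<gamma> * (LINT x:{0<..}|lborel.
              (- (real k * lam) * p m x + lam * (\<Sum>j = 1..min m k. p (m - j) x)) * h x t)
           + h 0 t * dp0 m))
        in (\<forall>t>0. (phat m has_real_derivative R t) (at t)) \<and>
           (\<forall>\<phi>. test_function_on UNIV \<phi> \<longrightarrow>
              dist_deriv (causal_dist (phat m)) \<phi>
                = causal_dist R \<phi> - dirac_delta \<phi> * phat m 0)) \<and>
     (let R = (\<lambda>t. 1 / (2 * \<delta>\<^sup>2) *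
          ((LINT x:{0<..}|lborel. (real k * lam)\<^sup>2 * p 0 x * h x t)
           - 2 * real k * lam * \<delta> * \<gamma> * (LINT x:{0<..}|lborel. p 0 x * h x t)
           - real k * lam * h 0 t))
      in (\<forall>t>0. (phat 0 has_real_derivative R t) (at t)) \<and>
         (\<forall>\<phi>. test_function_on {0<..} \<phi> \<longrightarrow>
            dist_deriv (causal_dist (phat 0)) \<phi>
              = causal_dist R \<phi> - dirac_delta \<phi> * phat 0 0))"
proof -
  note par = assms(3,4) and k = assms(1) and lam = assms(2) and data = assms(6) and G = assms(9)
  interpret prob_space M by fact
  \<comment> \<open>\<open>p m x\<close> is controlled for x \<ge> 0 only; \<open>q\<close> agrees
    with it there and is smooth on the whole line. Integration by parts is applied to
    \<open>q1\<close>, hence derivatives up to \<open>q3\<close>.\<close>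
  define q where "q = ppok_pmf k lam"
  define q1 where "q1 = ppok_generator k lam q"
  define q2 where "q2 = ppok_generator k lam q1"
  define q3 where "q3 = ppok_generator k lam q2"
  have d: "(q m has_real_derivative q1 m x) (at x)" for m x
    unfolding q_def q1_def by (rule ppok_pmf_has_derivative[OF k])
  have d1: "(q1 m has_real_derivative q2 m x) (at x)" for m x
    unfolding q1_def q2_def by (rule ppok_generator_has_derivative) (rule d[unfolded q1_def])
  have d2: "(q2 m has_real_derivative q3 m x) (at x)" for m x
    unfolding q2_def q3_def by (rule ppok_generator_has_derivative) (rule d1[unfolded q2_def])
  have d3: "(q3 m has_real_derivative ppok_generator k lam q3 m x) (at x)" for m x
    unfolding q3_def by (rule ppok_generator_has_derivative) (rule d2[unfolded q3_def])
  have c: "isCont (q m) x" "isCont (q1 m) x" "isCont (q2 m) x" "isCont (q3 m) x" for m x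
    using DERIV_isCont[OF d] DERIV_isCont[OF d1] DERIV_isCont[OF d2] DERIV_isCont[OF d3] by auto
  have qm[measurable]: "q m \<in> borel_measurable borel" "q1 m \<in> borel_measurable borel"
    "q2 m \<in> borel_measurable borel" for m
    using c by (auto intro!: borel_measurable_continuous_onI continuous_at_imp_continuous_on)
  have pq: "p m x = q m x" if "x \<ge> 0" for m x
    using prob_ppok[OF k lam data that] by (simp add: assms(7,8) q_def)
  define L where "L = 2 * real k * lam"
  \<comment> \<open>Each application of the generator costs a factor \<open>L\<close>; the maximum
    gives one constant for all four families, whether or not \<open>L\<close> exceeds 1.\<close>
  define B where "B = max (max 1 L) (max (L * L) (L * (L * L)))"
  have b0: "\<bar>q m x\<bar> \<le> 1" if "x \<ge> 0" for m x
    using pq[OF that, of m] assms(8) by (metis abs_of_nonneg measure_nonneg prob_le_1)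
  have b1: "\<bar>q1 m x\<bar> \<le> L" if "x \<ge> 0" for m x
    using ppok_generator_bounded[where u = q, OF lam b0[OF that]] by (simp add: q1_def L_def)
  have b2: "\<bar>q2 m x\<bar> \<le> L * L" if "x \<ge> 0" for m x
    using ppok_generator_bounded[where u = q1, OF lam b1[OF that]] by (simp add: q2_def L_def)
  have b3: "\<bar>q3 m x\<bar> \<le> L * (L * L)" if "x \<ge> 0" for m x
    using ppok_generator_bounded[where u = q2, OF lam b2[OF that]] by (simp add: q3_def L_def)
  have B: "\<bar>q m x\<bar> \<le> B" "\<bar>q1 m x\<bar> \<le> B" "\<bar>q2 m x\<bar> \<le> B" "\<bar>q3 m x\<bar> \<le> B" if "0 < x" for m x
    using b0[of x m] b1[of x m] b2[of x m] b3[of x m] that unfolding B_def by linarith+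
  have q10: "q1 m 0 = dp0 m" for m
    unfolding q1_def q_def assms(16) by (rule ppok_generator_ppok_pmf_0)

  have Enn: "0 \<le> E t \<omega>" for t \<omega> unfolding assms(10) by (rule first_exit_time_nonneg)
  have half: "set_integrable lborel {0<..} (\<lambda>x. h x t)" "AE \<omega> in M. E t \<omega> \<noteq> x"
    and expE_h: "\<And>Q. Q \<in> borel_measurable borel \<Longrightarrow>
      expectation (\<lambda>\<omega>. Q (E t \<omega>)) = (LINT x:{0<..}|lborel. Q x * h x t)" if "t > 0" for t x
    using distributed_half_line[OF assms(13)[OF that] assms(12)[OF that]] by auto
  have Em[measurable]: "E t \<in> borel_measurable M" if "t > 0" for t
    using assms(13)[OF that] by (simp add: distributed_def)
  have tail: "\<P>(\<omega> in M. x \<le> E t \<omega>) = ig_cdf \<delta> \<gamma> x t" if "t > 0" "x > 0" for t x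
    using first_exit_time_tail[OF par that G] Em[OF that(1)] half(2)[OF that(1)]
    unfolding assms(10) by blast
  have tail_int: "set_integrable lborel {0<..} (\<lambda>x. \<P>(\<omega> in M. x \<le> E t \<omega>))" if "t > 0" for t
    using ig_cdf_integrable_space[OF par that] tail[OF that]
    by (subst set_integrable_cong[where f' = "\<lambda>x. ig_cdf \<delta> \<gamma> x t"]) auto
  have expE: "expectation (\<lambda>\<omega>. f (E t \<omega>)) = f 0 + (LINT x:{0<..}|lborel. f' x * ig_cdf \<delta> \<gamma> x t)"
    if t: "t > 0" and f: "\<And>x. (f has_real_derivative f' x) (at x)" "\<And>x. isCont f' x"
      "\<And>x. 0 < x \<Longrightarrow> \<bar>f' x\<bar> \<le> B" for f f' t
  proof -
    have "expectation (\<lambda>\<omega>. f (E t \<omega>)) = f 0 + (LINT x:{0<..}|lborel. f' x * \<P>(\<omega> in M. x \<le> E t \<omega>))"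
      by (rule expectation_by_tail(2)[OF Em[OF t] Enn f tail_int[OF t]])
    also have "(LINT x:{0<..}|lborel. f' x * \<P>(\<omega> in M. x \<le> E t \<omega>))
        = (LINT x:{0<..}|lborel. f' x * ig_cdf \<delta> \<gamma> x t)"
      by (rule set_lebesgue_integral_cong) (use tail[OF t] in auto)
    finally show ?thesis .
  qed
  have h0: "h 0 t = ig_exit_density \<delta> \<gamma> 0 t" if t: "t > 0" for t
  proof (rule density_limit_at_0[where f = "\<lambda>x. h x t" and F = "\<lambda>x. - ig_cdf \<delta> \<gamma> x t"])
    show "set_integrable lborel {0<..} (\<lambda>x. h x t)" by (rule half(1)[OF t])
    show "((\<lambda>x. - ig_cdf \<delta> \<gamma> x t) has_real_derivative ig_exit_density \<delta> \<gamma> 0 t) (at 0)"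
      using DERIV_minus[OF ig_cdf_has_derivative_space[OF t, of \<delta> \<gamma> 0]] by simp
    show "(LINT y:{0<..<x}|lborel. h y t) = - ig_cdf \<delta> \<gamma> x t - - ig_cdf \<delta> \<gamma> 0 t" if x: "x > 0" for x
    proof -
      have "(LINT y:{0<..<x}|lborel. h y t) = (LINT y:{0<..}|lborel. indicator {..<x} y * h y t)"
        unfolding set_lebesgue_integral_def
        by (intro Bochner_Integration.integral_cong) (auto simp: indicator_def)
      also have "\<dots> = expectation (\<lambda>\<omega>. indicator {..<x} (E t \<omega>))"
        by (rule expE_h[OF t, symmetric]) auto
      also have "\<dots> = expectation (indicator {\<omega> \<in> space M. \<not> x \<le> E t \<omega>})"
        by (rule Bochner_Integration.integral_cong) (auto simp: indicator_def)
      also have "\<dots> = 1 - \<P>(\<omega> in M. x \<le> E t \<omega>)"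
        using Em[OF t] by (simp add: prob_neg)
      finally show ?thesis using tail[OF t x] ig_cdf_zero[OF t] by simp
    qed
  qed (rule assms(14)[OF t])
  have ind: "indep_set (process_sigma M {0..} borel E) (process_sigma M {0..} (count_space UNIV) N)"
    using assms(11) by (simp add: indep_processes_def)
  have phat: "phat m t = expectation (\<lambda>\<omega>. q m (E t \<omega>))" if t: "t > 0" for m t
    unfolding assms(15)
  proof (rule prob_at_independent_time[OF Em[OF t] Enn])
    fix x :: real assume x: "x \<ge> 0"
    have N: "{\<omega> \<in> space M. N x \<omega> = m} \<in> process_sigma M {0..} (count_space UNIV) N"
      using event_in_process_sigma[of x "{0..}" "{m}" "count_space UNIV" M N] x by simp
    then show "{\<omega> \<in> space M. N x \<omega> = m} \<in> events" using indep_setD_ev2[OF ind] by blast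
    fix A :: "real set" assume "A \<in> sets borel"
    then have "{\<omega> \<in> space M. E t \<omega> \<in> A} \<in> process_sigma M {0..} borel E"
      using t by (intro event_in_process_sigma) auto
    then show "prob ({\<omega> \<in> space M. E t \<omega> \<in> A} \<inter> {\<omega> \<in> space M. N x \<omega> = m})
        = \<P>(\<omega> in M. E t \<omega> \<in> A) * \<P>(\<omega> in M. N x \<omega> = m)"
      by (rule indep_setD[OF ind _ N])
  next
    show "continuous_on UNIV (q m)"
      using c(1) by (intro continuous_at_imp_continuous_on) auto
  qed (use pq ppok_right_continuous[OF data] in \<open>auto simp: assms(7,8)\<close>)

  \<comment> \<open>\<open>K m\<close> is the time derivative of the tail integral of
    \<open>q1 m\<close>, and \<open>R m\<close> the right-hand side of the theorem. The dependence
    of \<open>R\<close> on t passes through \<open>h\<close>; its continuity and integrability in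
    time are inherited from \<open>K\<close>.\<close>
  define K where "K m u = (LINT x:{0<..}|lborel. q1 m x * ig_density \<delta> \<gamma> x u)" for m u
  define R where "R m t = 1 / (2 * \<delta>\<^sup>2) * ((LINT x:{0<..}|lborel. q2 m x * h x t)
      + 2 * \<delta> * \<gamma> * (LINT x:{0<..}|lborel. q1 m x * h x t) + h 0 t * dp0 m)" for m t
  \<comment> \<open>The boundary values \<open>q2 m 0\<close> and 2 \<delta> \<gamma>
    \<open>q1 m 0\<close> from the integration by parts are exactly what the tail formula needs to
    turn the integrals of \<open>q3\<close> and \<open>q2\<close> against \<open>ig_cdf\<close> into
    expectations of \<open>q2\<close> and \<open>q1\<close>.\<close>
  have RK: "R m t = K m t" if t: "t > 0" for m t
  proof -
    have "2 * \<delta>\<^sup>2 * K m t = expectation (\<lambda>\<omega>. q2 m (E t \<omega>))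
        + 2 * \<delta> * \<gamma> * expectation (\<lambda>\<omega>. q1 m (E t \<omega>)) + h 0 t * dp0 m"
      using ig_density_space_integral[OF par t d1[of m] d2 c(4) B(2-4)]
        expE[OF t d1[of m] c(3) B(3)] expE[OF t d2[of m] c(4) B(4)] h0[OF t] q10[of m]
      by (simp add: K_def algebra_simps)
    also have "\<dots> = 2 * \<delta>\<^sup>2 * R m t"
      unfolding R_def expE_h[OF t qm(2)] expE_h[OF t qm(3)] using par by simp
    finally show ?thesis using par by simp
  qed
  have Kc: "isCont (K m) t" if "t > 0" for m t
    unfolding K_def[abs_def] by (rule ig_density_integral_continuous[OF par that d1 d2 c(4) B(2-4)])
  have near: "\<forall>\<^sub>F s in nhds t. 0 < s" if "t > 0" for t :: real
    using eventually_nhds_in_open[of "{0<..}" t] that by simp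
  let ?S = "\<lambda>m t. LINT x:{0<..}|lborel. q1 m x * ig_cdf \<delta> \<gamma> x t"
  have phatS: "phat m t = q m 0 + ?S m t" if "t > 0" for m t
    using phat[OF that] expE[OF that d c(2) B(2)] by simp
  have der: "(phat m has_real_derivative R m t) (at t)" if t: "t > 0" for m t
  proof -
    have "((\<lambda>t. q m 0 + ?S m t) has_real_derivative 0 + K m t) (at t)"
      unfolding K_def
      by (intro DERIV_add DERIV_const ig_tail_integral_has_derivative[OF par qm(2) B(2)] t
            Kc[unfolded K_def[abs_def]])
    then have "((\<lambda>t. q m 0 + ?S m t) has_real_derivative R m t) (at t)"
      using RK[OF t] by simp
    then show ?thesis
      by (rule DERIV_cong_ev[OF refl _ refl, THEN iffD1, rotated])
         (use near[OF t] in eventually_elim, simp add: phatS)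
  qed
  have distr: "dist_deriv (causal_dist (phat m)) \<phi> = causal_dist (R m) \<phi> + dirac_delta \<phi> * q m 0"
    if \<phi>: "test_function_on U \<phi>" for m \<phi> U
  proof (rule dist_deriv_causal[OF der _ _ _ _ \<phi>, where B = 1])
    show "isCont (R m) t" if t: "t > 0" for t
      by (rule isCont_cong[THEN iffD1, rotated, OF Kc[OF t]])
         (use near[OF t] in eventually_elim, simp add: RK)
    show "set_integrable lborel {0<..T} (R m)" if "T > 0" for T
      using ig_space_time_Fubini(1)[OF par that qm(2) B(2)] RK
      by (subst set_integrable_cong[where f' = "K m"]) (auto simp: K_def[abs_def])
    show "\<bar>phat m t\<bar> \<le> 1" for t unfolding assms(15) by simp
    have "((\<lambda>t. q m 0 + ?S m t) \<longlongrightarrow> q m 0 + 0) (at_right 0)"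
      by (intro tendsto_add tendsto_const ig_tail_integral_continuous(2)[OF par qm(2) B(2)])
    then show "(phat m \<longlongrightarrow> q m 0) (at_right 0)"
      unfolding add_0_right
      by (rule Lim_transform_eventually)
         (use eventually_at_right_less[of "0::real"] in eventually_elim, simp add: phatS)
  qed
  \<comment> \<open>A density of \<open>E t\<close> is given for t > 0 only, so the event at time 0
    may fail to be measurable; in that case its measure is 0 by convention.\<close>
  have phat0: "phat m 0 = 0" if m: "m \<ge> 1" for m
  proof (cases "{\<omega> \<in> space M. N (E 0 \<omega>) \<omega> = m} \<in> events")
    case True
    have "AE \<omega> in M. P 0 \<omega> = 0"
      using data by (simp add: ppok_data_def poisson_process_def levy_process_def)
    with first_exit_time_0[OF par G] AE_space have "AE \<omega> in M. N (E 0 \<omega>) \<omega> \<noteq> m"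
    proof eventually_elim
      case (elim \<omega>)
      then show ?case using m data by (simp add: assms(7,10) ppok_def ppok_data_def)
    qed
    then show ?thesis using True unfolding assms(15) by (simp add: prob_eq_0)
  next
    case False
    then show ?thesis unfolding assms(15) by (rule measure_notin_sets)
  qed

  \<comment> \<open>One-sided, since \<open>p\<close> and \<open>q\<close> agree only for x \<ge>
    0.\<close>
  have p0: "(p m has_real_derivative dp0 m) (at 0 within {0..})" for m
    by (rule has_field_derivative_transform_within[where f = "q m" and d = 1])
       (use pq has_field_derivative_at_within[OF d[of m 0]] q10 in auto)
  have R_pos: "R m = (\<lambda>t. 1 / (2 * \<delta>\<^sup>2) *
          ((LINT x:{0<..}|lborel.
              ((real k * lam)\<^sup>2 * p m x
               - 2 * real k * lam\<^sup>2 * (\<Sum>j = 1..min m k. p (m - j) x)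
               + lam\<^sup>2 * (\<Sum>j = 1..min m k. \<Sum>i = 1..min (m - j) k. p (m - j - i) x)) * h x t)
           + 2 * \<delta> * \<gamma> * (LINT x:{0<..}|lborel.
              (- (real k * lam) * p m x + lam * (\<Sum>j = 1..min m k. p (m - j) x)) * h x t)
           + h 0 t * dp0 m))" for m
  proof
    fix t
    have 1: "(LINT x:{0<..}|lborel. q2 m x * h x t) = (LINT x:{0<..}|lborel.
              ((real k * lam)\<^sup>2 * p m x
               - 2 * real k * lam\<^sup>2 * (\<Sum>j = 1..min m k. p (m - j) x)
               + lam\<^sup>2 * (\<Sum>j = 1..min m k. \<Sum>i = 1..min (m - j) k. p (m - j - i) x)) * h x t)"
      by (rule set_lebesgue_integral_cong) (auto simp: q2_def q1_def ppok_generator_twice pq)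
    have 2: "(LINT x:{0<..}|lborel. q1 m x * h x t) = (LINT x:{0<..}|lborel.
              (- (real k * lam) * p m x + lam * (\<Sum>j = 1..min m k. p (m - j) x)) * h x t)"
      by (rule set_lebesgue_integral_cong) (auto simp: q1_def ppok_generator_def pq)
    show "R m t = 1 / (2 * \<delta>\<^sup>2) *
          ((LINT x:{0<..}|lborel.
              ((real k * lam)\<^sup>2 * p m x
               - 2 * real k * lam\<^sup>2 * (\<Sum>j = 1..min m k. p (m - j) x)
               + lam\<^sup>2 * (\<Sum>j = 1..min m k. \<Sum>i = 1..min (m - j) k. p (m - j - i) x)) * h x t)
           + 2 * \<delta> * \<gamma> * (LINT x:{0<..}|lborel.
              (- (real k * lam) * p m x + lam * (\<Sum>j = 1..min m k. p (m - j) x)) * h x t)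
           + h 0 t * dp0 m)"
      unfolding R_def 1 2 ..
  qed
  have R_0: "R 0 = (\<lambda>t. 1 / (2 * \<delta>\<^sup>2) *
          ((LINT x:{0<..}|lborel. (real k * lam)\<^sup>2 * p 0 x * h x t)
           - 2 * real k * lam * \<delta> * \<gamma> * (LINT x:{0<..}|lborel. p 0 x * h x t)
           - real k * lam * h 0 t))"
  proof
    fix t
    have 1: "(LINT x:{0<..}|lborel. (- (real k * lam) * p 0 x) * h x t)
        = - (real k * lam) * (LINT x:{0<..}|lborel. p 0 x * h x t)"
      by (simp only: mult.assoc set_integral_mult_right)
    show "R 0 t = 1 / (2 * \<delta>\<^sup>2) *
          ((LINT x:{0<..}|lborel. (real k * lam)\<^sup>2 * p 0 x * h x t)
           - 2 * real k * lam * \<delta> * \<gamma> * (LINT x:{0<..}|lborel. p 0 x * h x t)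
           - real k * lam * h 0 t)"
      using 1 unfolding R_pos assms(16) by (simp add: algebra_simps)
  qed
  \<comment> \<open>The jump \<open>q m 0\<close> and the value \<open>phat m 0\<close> are both 0
    here, so both delta terms vanish on every test function.\<close>
  have "dist_deriv (causal_dist (phat m)) \<phi> = causal_dist (R m) \<phi> - dirac_delta \<phi> * phat m 0"
    if "m \<ge> 1" "test_function_on UNIV \<phi>" for m \<phi>
    using distr[OF that(2), of m] phat0[OF that(1)] that(1) by (simp add: q_def ppok_pmf_0)
  \<comment> \<open>The jump is \<open>q 0 0\<close>, which enters with a plus sign; test functions
    supported in positive times vanish at 0, which makes either delta term 0.\<close>
  moreover have "dist_deriv (causal_dist (phat 0)) \<phi> = causal_dist (R 0) \<phi> - dirac_delta \<phi> * phat 0 0"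
    if "test_function_on {0<..} \<phi>" for \<phi>
    using distr[OF that, of 0] test_functionD(4)[OF that] by (simp add: dirac_delta_def)
  ultimately show ?thesis
    unfolding R_pos[symmetric] R_0[symmetric] Let_def using p0 der by blast
qed

end
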